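(* Let $\mathcal H$ be a real Hilbert space, let $F\colon\mathcal H\to\mathbb R$ be a convex function which is differentiable on $\mathcal H$ with a $\beta$-Lipschitz continuous gradient for some $\beta\in]0,+\infty[$. Let $G\in\Gamma_0(\mathcal H)$, set $J=F+G$, and suppose that $\operatorname{Argmin}J\neq\varnothing$. Let $(\gamma_m)_{m\in\mathbb N}$ be a sequence in $]0,+\infty[$ such that $0<\inf_m\gamma_m\le\sup_m\gamma_m<2/\beta$, and let $(\tau_m)_{m\in\mathbb N}$ be a sequence in $]0,1]$ such that $\inf_m\tau_m>0$. Let $(\delta_m)_{m\in\mathbb N}$ be a summable sequence in $[0,+\infty[$ and let $(b_m)_{m\in\mathbb N}$ be a sequence in $\mathcal H$ with $\sum_m\|b_m\|<+\infty$. Fix $u_0\in\mathcal H$ and let $(u_m)_{m\in\mathbb N}$, $(v_m)_{m\in\mathbb N}$ be sequences in $\mathcal H$ such that, for every $m\in\mathbb N$, $$v_m\simeq_{\delta_m}\operatorname{prox}_{\gamma_mG}\big(u_m-\gamma_m(\nabla F(u_m)+b_m)\big),\qquad u_{m+1}=u_m+\tau_m(v_m-u_m).$$ Then the following hold: \begin{enumerate} \item[(i)] $(u_m)_{m\in\mathbb N}$ converges weakly to a point in $\operatorname{Argmin}J$. \item[(ii)] For every $u\in\operatorname{Argmin}J$, $\sum_{m\in\mathbb N}\|\nabla F(u_m)-\nabla F(u)\|^2<+\infty$. \item[(iii)] $\sum_{m\in\mathbb N}\|v_m-u_m\|^2<+\infty$. \item[(iv)] $J(u_m)\to\inf J(\mathcal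 H)$ and $\sum_{m\in\mathbb N}|J(v_m)-\inf J(\mathcal H)|^2<+\infty$. \item[(v)] Suppose that $\sum_{m\in\mathbb N}(1-\tau_m)<+\infty$. Then $\sum_{m\in\mathbb N}\big(J(v_m)-\inf J(\mathcal H)\big)<+\infty$ and $\sum_{m\in\mathbb N}\big(J(u_m)-\inf J(\mathcal H)\big)<+\infty$. \item[(vi)] Suppose that $\sum_{m\in\mathbb N}(1-\tau_m)<+\infty$, $\sum_{m\in\mathbb N}m\delta_m<+\infty$, and $\sum_{m\in\mathbb N}m\|b_m\|<+\infty$. Then $J(u_m)-\inf J(\mathcal H)=o(1/m)$. \end{enumerate}
   Context: $\Gamma_0(\mathcal H)$ is the set of proper lower semicontinuous convex functions from $\mathcal H$ to $]-\infty,+\infty]$. For $\varphi\in\Gamma_0(\mathcal H)$, $\operatorname{prox}_\varphi w=\operatorname{argmin}_{v\in\mathcal H}\big(\varphi(v)+\frac12\|w-v\|^2\big)$. For $\varphi\in\Gamma_0(\mathcal H)$, $(u,w)\in\mathcal H^2$, and $\delta\in[0,+\infty[$, the notation $u\simeq_\delta\operatorname{prox}_\varphi w$ means that $$\varphi(u)+\tfrac12\|u-w\|^2\le\min_{v\in\mathcal H}\Big(\varphi(v)+\tfrac12\|v-w\|^2\Big)+\frac{\delta^2}{2}.$$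
   Formalization: In (iv), J(u_m)→inf J, and in (vi), it is additionally assumed that some iterate u_k lies in dom G; in (v), summability of J(u_m)−inf J assumes G(u_0)<+∞. Otherwise J(u_m) can be +∞ for all m (F=0, G the indicator of {0}, u_0=1, τ_m<1), or at m=0. *)

theory Defs
  imports "HOL-Analysis.Analysis" "HOL-Library.Landau_Symbols"
begin

text \<open>
  Functions with values in $]-\infty,+\infty]$ are rendered as functions into \<^typ>\<open>ereal\<close> that never
  take the value $-\infty$; this is part of \<open>proper\<close>. A real Hilbert space is a type of sort
  \<open>{real_inner, complete_space}\<close>.
\<close>

definition proper :: "('a \<Rightarrow> ereal) \<Rightarrow> bool" where
  "proper f \<longleftrightarrow> (\<forall>x. f x \<noteq> -\<infinity>) \<and> (\<exists>x. f x \<noteq> \<infinity>)"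

definition lower_semicontinuous :: "('a::topological_space \<Rightarrow> ereal) \<Rightarrow> bool" where
  "lower_semicontinuous f \<longleftrightarrow> (\<forall>x. f x \<le> Liminf (nhds x) f)"

text \<open>
  The weights lie in the open unit interval, so no product of 0 with an infinite value occurs.
\<close>

definition econvex :: "('a::real_vector \<Rightarrow> ereal) \<Rightarrow> bool" where
  "econvex f \<longleftrightarrow> (\<forall>x y. \<forall>t. 0 < t \<and> t < 1 \<longrightarrow>
     f (t *\<^sub>R x + (1 - t) *\<^sub>R y) \<le> ereal t * f x + ereal (1 - t) * f y)"

definition Gamma0 :: "('a::real_normed_vector \<Rightarrow> ereal) set" where
  "Gamma0 = {f. proper f \<and> lower_semicontinuous f \<and> econvex f}"

definition Argmin :: "('a \<Rightarrow> ereal) \<Rightarrow> 'a set" where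
  "Argmin f = {x. is_arg_min f (\<lambda>_. True) x}"

text \<open>
  \<open>approx_prox \<delta> \<phi> w u\<close> is $u \simeq_\delta \mathrm{prox}_\varphi w$. For \<open>\<phi> \<in> Gamma0\<close> on a Hilbert
  space the infimum below is attained, hence it is the minimum of the usual definition.
\<close>

definition approx_prox :: "real \<Rightarrow> ('a::real_normed_vector \<Rightarrow> ereal) \<Rightarrow> 'a \<Rightarrow> 'a \<Rightarrow> bool" where
  "approx_prox \<delta> \<phi> w u \<longleftrightarrow>
     \<phi> u + ereal (1/2 * (norm (u - w))\<^sup>2)
       \<le> (INF v. \<phi> v + ereal (1/2 * (norm (v - w))\<^sup>2)) + ereal (\<delta>\<^sup>2 / 2)"

definition weakly_converges :: "(nat \<Rightarrow> 'a::real_inner) \<Rightarrow> 'a \<Rightarrow> bool" where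
  "weakly_converges x l \<longleftrightarrow> (\<forall>y. (\<lambda>n. x n \<bullet> y) \<longlonglongrightarrow> l \<bullet> y)"

end

theory Submission
  imports Defs
begin

text \<open>
  Moving from an approximate proximal point \<open>v\<close> towards \<open>z\<close> yields the inequality
  \<open>\<phi> v - \<phi> z \<le> (z - v) \<bullet> (v - w) + \<delta> * norm (z - v) + \<delta>\<^sup>2\<close>, so the exact proximal point
  is never needed. With \<open>z\<close> a minimizer, cocoercivity of the gradient and \<open>\<gamma> < 2 / \<beta>\<close> turn it
  into a quasi-Fejer inequality that controls \<open>v - u\<close> and the gradient differences. With the
  descent lemma it bounds the objective gap at \<open>v\<close> by the decrease of the squared distance to the
  minimizer, and with \<open>z = u\<close> it makes the objective decrease up to an error, which gives the rate.
  Weak convergence follows Opial's argument with the intersection of the closed convex hulls of the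
  tails in place of the set of weak cluster points.
\<close>

section \<open>Convex functions with Lipschitz gradient\<close>

text \<open>The relaxed points \<open>u m\<close> may lie outside the domain of \<open>G\<close>,
  where \<open>J\<close> is infinite, while every \<open>v m\<close> lies in it. Hence the analysis
  uses finite values \<open>g\<close> on a convex set \<open>D\<close>, weak limits are sought along
  \<open>v\<close>, and claims on \<open>J (u m)\<close> ask that some \<open>u k\<close> (for the
  series over all \<open>m\<close>, \<open>u 0\<close>) lie in the domain, which later iterates then
  never leave. Both perturbations merge into one summable error \<open>e m\<close>. The obstacle is
  that this error is multiplied by the distance \<open>norm (v m - x)\<close>, which is not known to
  be bounded: completing a square first bounds it by \<open>norm (u m - x) + 3 * e m\<close>, and
  only then can the inequality be summed. For steps up to \<open>2 / \<beta>\<close> the descent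
  lemma leaves a multiple of \<open>(norm (v m - u m))\<^sup>2\<close> in the bound on the objective
  gap; the strict bound on the steps pays for it, since it makes these squares summable.\<close>

lemma GDERIV_along_line:
  assumes "GDERIV F (x + s *\<^sub>R d) :> D"
  shows "((\<lambda>s. F (x + s *\<^sub>R d)) has_real_derivative D \<bullet> d) (at s)"
proof -
  have "((\<lambda>s. F (x + s *\<^sub>R d)) has_derivative (\<lambda>h. (h *\<^sub>R d) \<bullet> D)) (at s)"
    using assms unfolding gderiv_def
    by (rule has_derivative_compose[of "\<lambda>s. x + s *\<^sub>R d" "\<lambda>h. h *\<^sub>R d" s UNIV F, rotated])
       (auto intro!: derivative_eq_intros)
  moreover have "(\<lambda>h. (h *\<^sub>R d) \<bullet> D) = (*) (D \<bullet> d)"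
    by (simp add: fun_eq_iff inner_commute)
  ultimately show ?thesis by (simp add: has_field_derivative_def)
qed

text \<open>Along the segment, \<open>F\<close> minus its quadratic upper model has nonpositive
  derivative, by Cauchy-Schwarz and the Lipschitz bound. The statement covers nonconvex
  \<open>F\<close> because it is also applied to \<open>- F\<close>.\<close>

lemma lipschitz_gradient_descent:
  fixes F :: "'a::real_inner \<Rightarrow> real"
  assumes F: "\<And>x. GDERIV F x :> gradF x" and L: "\<beta>-lipschitz_on UNIV gradF"
  shows "F z \<le> F y + gradF y \<bullet> (z - y) + \<beta> / 2 * (norm (z - y))\<^sup>2"
proof -
  define d where "d = z - y"
  define \<psi> where "\<psi> s = F (y + s *\<^sub>R d) - s * (gradF y \<bullet> d) - \<beta> / 2 * s\<^sup>2 * (norm d)\<^sup>2" for s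
  have "\<psi> 1 \<le> \<psi> 0"
  proof (rule DERIV_nonpos_imp_nonincreasing[of 0 1])
    fix s :: real
    assume s: "0 \<le> s" "s \<le> 1"
    have "(gradF (y + s *\<^sub>R d) - gradF y) \<bullet> d \<le> norm (gradF (y + s *\<^sub>R d) - gradF y) * norm d"
      by (rule norm_cauchy_schwarz)
    also have "\<dots> \<le> (\<beta> * (s * norm d)) * norm d"
      using lipschitz_onD[OF L, of "y + s *\<^sub>R d" y] s
      by (intro mult_right_mono) (auto simp: dist_norm)
    finally have "gradF (y + s *\<^sub>R d) \<bullet> d - gradF y \<bullet> d - \<beta> * s * (norm d)\<^sup>2 \<le> 0"
      by (simp add: inner_diff_left power2_eq_square algebra_simps)
    moreover have "(\<psi> has_real_derivative
        gradF (y + s *\<^sub>R d) \<bullet> d - gradF y \<bullet> d - \<beta> * s * (norm d)\<^sup>2) (at s)"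
      unfolding \<psi>_def
      by (rule derivative_eq_intros GDERIV_along_line F refl | simp)+
    ultimately show "\<exists>D. DERIV \<psi> s :> D \<and> D \<le> 0" by blast
  qed simp
  then show ?thesis by (simp add: \<psi>_def d_def)
qed

text \<open>Stands in for a difference quotient: estimates along a segment are divided by
  \<open>t\<close>, and the second order remainder \<open>t * k\<close> vanishes as \<open>t\<close>
  tends to 0.\<close>

lemma le_of_le_add_small_multiple:
  fixes a c k :: real
  assumes "\<And>t. 0 < t \<Longrightarrow> t < 1 \<Longrightarrow> a \<le> c + t * k"
  shows "a \<le> c"
proof (rule tendsto_le[of "at_right 0"])
  show "((\<lambda>t. c + t * k) \<longlongrightarrow> c) (at_right 0)"
    by (auto intro!: tendsto_eq_intros)
  show "\<forall>\<^sub>F t in at_right 0. a \<le> c + t * k"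
    unfolding eventually_at_right_field using assms by (intro exI[of _ 1]) auto
qed auto

text \<open>The descent lemma for \<open>- F\<close> bounds \<open>F\<close> from below to first
  order near \<open>y\<close>, while convexity bounds it from above by the chord to
  \<open>z\<close>.\<close>

lemma convex_gradient_inequality:
  fixes F :: "'a::real_inner \<Rightarrow> real"
  assumes F: "\<And>x. GDERIV F x :> gradF x" and L: "\<beta>-lipschitz_on UNIV gradF"
    and conv: "convex_on UNIV F"
  shows "F y + gradF y \<bullet> (z - y) \<le> F z"
proof (rule le_of_le_add_small_multiple)
  fix t :: real
  assume t: "0 < t" "t < 1"
  have "\<beta>-lipschitz_on UNIV (\<lambda>x. - gradF x)"
    using L by (simp add: lipschitz_on_def dist_minus)
  moreover have "GDERIV (\<lambda>x. - F x) x :> - gradF x" for x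
    by (rule GDERIV_minus[OF F])
  ultimately have "- F (y + t *\<^sub>R (z - y)) \<le> - F y + (- gradF y) \<bullet> (t *\<^sub>R (z - y))
      + \<beta> / 2 * (norm (t *\<^sub>R (z - y)))\<^sup>2"
    using lipschitz_gradient_descent[of "\<lambda>x. - F x" "\<lambda>x. - gradF x" \<beta> "y + t *\<^sub>R (z - y)" y]
    by simp
  moreover have "F (y + t *\<^sub>R (z - y)) \<le> (1 - t) * F y + t * F z"
    using convex_onD[OF conv, of t y z] t by (simp add: algebra_simps)
  ultimately have "t * (F y + gradF y \<bullet> (z - y)) \<le> t * (F z + t * (\<beta> / 2 * (norm (z - y))\<^sup>2))"
    by (simp add: power_mult_distrib power2_eq_square[of t] distrib_left[of t] left_diff_distrib right_diff_distrib mult_ac)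
  then show "F y + gradF y \<bullet> (z - y) \<le> F z + t * (\<beta> / 2 * (norm (z - y))\<^sup>2)"
    using t by simp
qed

text \<open>Compare \<open>z\<close> with the point reached from it by a gradient step of length \<open>1 / \<beta>\<close>
  on \<open>\<lambda>z. F z - gradF y \<bullet> z\<close>, which is minimized at \<open>y\<close>.\<close>

lemma convex_gradient_inequality_strong:
  fixes F :: "'a::real_inner \<Rightarrow> real"
  assumes F: "\<And>x. GDERIV F x :> gradF x" and L: "\<beta>-lipschitz_on UNIV gradF"
    and conv: "convex_on UNIV F" and \<beta>: "0 < \<beta>"
  shows "F y + gradF y \<bullet> (z - y) + (norm (gradF z - gradF y))\<^sup>2 / (2 * \<beta>) \<le> F z"
proof -
  define D where "D = gradF z - gradF y"
  define p where "p = z - (1 / \<beta>) *\<^sub>R D"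
  have "F y + gradF y \<bullet> (p - y) \<le> F p"
    by (rule convex_gradient_inequality[OF F L conv])
  also have "F p \<le> F z + gradF z \<bullet> (p - z) + \<beta> / 2 * (norm (p - z))\<^sup>2"
    by (rule lipschitz_gradient_descent[OF F L])
  finally have "F y + gradF y \<bullet> (z - y) \<le> F z + D \<bullet> (p - z) + \<beta> / 2 * (norm (p - z))\<^sup>2"
    by (simp add: D_def inner_diff_left inner_diff_right)
  moreover have "D \<bullet> (p - z) = - ((norm D)\<^sup>2 / \<beta>)"
    by (simp add: p_def power2_norm_eq_inner)
  moreover have "\<beta> / 2 * (norm (p - z))\<^sup>2 = (norm D)\<^sup>2 / (2 * \<beta>)"
    using \<beta> by (simp add: p_def power2_eq_square field_simps)
  moreover have "(norm D)\<^sup>2 / \<beta> = 2 * ((norm D)\<^sup>2 / (2 * \<beta>))" by simp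
  ultimately show ?thesis unfolding D_def by linarith
qed

text \<open>This is the Baillon-Haddad inequality: the strengthened gradient inequality is added to
  itself with \<open>y\<close> and \<open>z\<close> exchanged.\<close>

lemma gradient_cocoercive:
  fixes F :: "'a::real_inner \<Rightarrow> real"
  assumes F: "\<And>x. GDERIV F x :> gradF x" and L: "\<beta>-lipschitz_on UNIV gradF"
    and conv: "convex_on UNIV F" and \<beta>: "0 < \<beta>"
  shows "(norm (gradF y - gradF z))\<^sup>2 / \<beta> \<le> (gradF y - gradF z) \<bullet> (y - z)"
  using convex_gradient_inequality_strong[OF assms, of y z]
    convex_gradient_inequality_strong[OF assms, of z y]
  by (simp add: norm_minus_commute[of "gradF z"] inner_diff_left inner_diff_right)

text \<open>Move from \<open>v\<close> towards \<open>z\<close> by the fraction \<open>t = \<delta> / norm (z - v)\<close> if this is less than 1,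
  and by \<open>t = 1\<close> otherwise.\<close>

lemma approx_minimizer_inequality:
  fixes h :: "'a::real_inner \<Rightarrow> real"
  assumes conv: "convex_on D h" and v: "v \<in> D" and z: "z \<in> D" and \<delta>: "0 \<le> \<delta>"
    and min: "\<And>y. y \<in> D \<Longrightarrow> h v + 1/2 * (norm (v - w))\<^sup>2 \<le> h y + 1/2 * (norm (y - w))\<^sup>2 + \<delta>\<^sup>2 / 2"
  shows "h v - h z \<le> (z - v) \<bullet> (v - w) + \<delta> * norm (z - v) + \<delta>\<^sup>2"
proof -
  define n where "n = norm (z - v)"
  \<comment> \<open>The defect \<open>\<delta>\<^sup>2 / 2\<close> is not scaled by
    \<open>t\<close>, so for positive \<open>\<delta>\<close> it is no use to let \<open>t\<close>
    tend to 0.\<close>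
  have step: "t * (h v - h z) \<le> t * ((z - v) \<bullet> (v - w)) + t\<^sup>2 / 2 * n\<^sup>2 + \<delta>\<^sup>2 / 2"
    if t: "0 < t" "t \<le> 1" for t
  proof -
    define y where "y = v + t *\<^sub>R (z - v)"
    have y: "y = (1 - t) *\<^sub>R v + t *\<^sub>R z" by (simp add: y_def algebra_simps)
    have "y \<in> D"
      unfolding y using convex_on_imp_convex[OF conv] v z t by (intro convexD) auto
    then have "h v + 1/2 * (norm (v - w))\<^sup>2 \<le> h y + 1/2 * (norm (y - w))\<^sup>2 + \<delta>\<^sup>2 / 2" by (rule min)
    moreover have "h y \<le> (1 - t) * h v + t * h z"
      unfolding y using t v z by (intro convex_onD[OF conv]) auto
    moreover have "(norm (y - w))\<^sup>2 = (norm (v - w))\<^sup>2 + 2 * t * ((z - v) \<bullet> (v - w)) + t\<^sup>2 * n\<^sup>2"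
      unfolding y_def n_def power2_norm_eq_inner
      by (simp add: algebra_simps inner_commute power2_eq_square)
    ultimately show ?thesis by (simp add: algebra_simps)
  qed
  show ?thesis
  proof (cases "\<delta> < n")
    case True
    show ?thesis
    proof (cases "\<delta> = 0")
      case True
      \<comment> \<open>Here the fraction \<open>\<delta> / n\<close> degenerates to 0 and is
        replaced by a limit.\<close>
      have "h v - h z \<le> (z - v) \<bullet> (v - w)"
      proof (rule le_of_le_add_small_multiple)
        fix t :: real
        assume t: "0 < t" "t < 1"
        then have "t * (h v - h z) \<le> t * ((z - v) \<bullet> (v - w) + t * (n\<^sup>2 / 2))"
          using step[of t] True by (simp add: algebra_simps power2_eq_square)
        then show "h v - h z \<le> (z - v) \<bullet> (v - w) + t * (n\<^sup>2 / 2)" using t by simp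
      qed
      then show ?thesis using True by simp
    next
      case False
      then have pos: "0 < \<delta>" "0 < n" using \<delta> True by auto
      \<comment> \<open>After division by \<open>t\<close> the remainder is
        \<open>t * n\<^sup>2 / 2 + \<delta>\<^sup>2 / (2 * t)\<close>; this \<open>t\<close>
        minimizes it, with value \<open>\<delta> * n\<close>.\<close>
      define t where "t = \<delta> / n"
      have t: "0 < t" "t \<le> 1" using pos True by (auto simp: t_def)
      have tn: "t * n = \<delta>" using pos by (simp add: t_def)
      have "t * (h v - h z) \<le> t * ((z - v) \<bullet> (v - w)) + (t * n)\<^sup>2 / 2 + (t * n)\<^sup>2 / 2"
        using step[OF t] by (simp add: tn power_mult_distrib[symmetric])
      also have "\<dots> = t * ((z - v) \<bullet> (v - w) + t * n * n)"
        by (simp add: power2_eq_square algebra_simps)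
      finally have "h v - h z \<le> (z - v) \<bullet> (v - w) + t * n * n" using t by simp
      then show ?thesis unfolding tn n_def[symmetric] by (simp add: add_increasing2)
    qed
  next
    \<comment> \<open>The fraction is capped at \<open>t = 1\<close>, where the remainder
      \<open>(n\<^sup>2 + \<delta>\<^sup>2) / 2\<close> is the origin of the term
      \<open>\<delta>\<^sup>2\<close> in the claim.\<close>
    case False
    then have "n\<^sup>2 \<le> \<delta>\<^sup>2" using n_def by (intro power_mono) auto
    moreover have "0 \<le> \<delta> * n" using \<delta> n_def by simp
    ultimately show ?thesis using step[of 1] unfolding n_def by simp
  qed
qed

section \<open>Weak convergence by nested convex hulls\<close>

definition tail_hull :: "(nat \<Rightarrow> 'a::real_normed_vector) \<Rightarrow> 'a set" where
  "tail_hull w = (\<Inter>n. closure (convex hull (w ` {n..})))"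

text \<open>Properties of points of the tail hull are obtained this way, with half-spaces and
  sublevel sets of the objective as \<open>C\<close>.\<close>

lemma tail_hull_subset:
  assumes "closed C" "convex C" "\<forall>\<^sub>F n in sequentially. w n \<in> C"
  shows "tail_hull w \<subseteq> C"
proof -
  obtain n where "w ` {n..} \<subseteq> C"
    using assms(3) unfolding eventually_sequentially by auto
  then have "closure (convex hull (w ` {n..})) \<subseteq> C"
    using assms by (intro closure_minimal hull_minimal) auto
  then show ?thesis unfolding tail_hull_def by blast
qed

lemma tail_hull_subseq:
  assumes "strict_mono r"
  shows "tail_hull (w \<circ> r) \<subseteq> tail_hull w"
  unfolding tail_hull_def
proof (intro INF_mono' closure_mono hull_mono)
  fix n
  show "(w \<circ> r) ` {n..} \<subseteq> w ` {n..}"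
    using seq_suble[OF assms] order_trans by fastforce
qed

text \<open>Near-minimizers of the norm over the nested hulls form a Cauchy sequence
  by the parallelogram law.\<close>

lemma tail_hull_nonempty:
  fixes w :: "nat \<Rightarrow> 'a::{real_inner, complete_space}"
  assumes bdd: "bounded (range w)"
  shows "tail_hull w \<noteq> {}"
proof -
  define C where "C n = closure (convex hull (w ` {n..}))" for n
  define d where "d n = (INF x\<in>C n. norm x)" for n
  obtain B where B: "\<And>n. norm (w n) \<le> B"
    using bdd unfolding bounded_iff by auto
  have wC: "w n \<in> C n" for n
    unfolding C_def by (intro subsetD[OF closure_subset] hull_inc) auto
  have conv: "convex (C n)" and closed: "closed (C n)" for n
    unfolding C_def by (auto intro: convex_closure)
  have mono: "C m \<subseteq> C n" if "n \<le> m" for n m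
    unfolding C_def using that by (intro closure_mono hull_mono) auto
  have below: "bdd_below (norm ` C n)" for n by (rule bdd_belowI2[of _ 0]) simp
  have d_le: "d n \<le> norm x" if "x \<in> C n" for n x
    unfolding d_def by (rule cINF_lower[OF below that])
  have d0: "0 \<le> d n" for n
    unfolding d_def using wC by (intro cINF_greatest) auto
  have d_mono: "d n \<le> d m" if "n \<le> m" for n m
    using wC[of m] d_le mono[OF that] unfolding d_def[of m] by (intro cINF_greatest) auto
  have dB: "d n \<le> B" for n using d_le[OF wC] B order_trans by blast
  have "\<exists>x. x \<in> C n \<and> norm x < d n + 1 / Suc n" for n
  proof -
    have "d n < d n + 1 / Suc n" by simp
    then show ?thesis
      unfolding d_def using wC[of n] below[of n] by (subst (asm) cINF_less_iff) auto
  qed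
  then obtain x where x: "\<And>n. x n \<in> C n" "\<And>n. norm (x n) < d n + 1 / Suc n" by metis
  have "convergent d"
    using d_mono dB by (intro Bseq_mono_convergent) (auto intro!: BseqI'[of _ B] simp: abs_of_nonneg d0)
  then obtain l where l: "d \<longlonglongrightarrow> l" unfolding convergent_def by blast
  have dl: "d n \<le> l" for n using d_mono by (intro LIMSEQ_le_const[OF l]) auto
  have l0: "0 \<le> l" using d0 dl order_trans by blast
  \<comment> \<open>Bounds \<open>(norm (x n - x m))\<^sup>2\<close> for all
    \<open>m \<ge> n\<close> at once: both norms are at most \<open>l + 1 / Suc n\<close>, and the
    midpoint, being in \<open>C n\<close>, has norm at least \<open>d n\<close>.\<close>
  define E where "E n = 4 * (l + 1 / Suc n)\<^sup>2 - 4 * (d n)\<^sup>2" for n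
  have E: "E \<longlonglongrightarrow> 0"
    unfolding E_def
    by (rule tendsto_eq_intros l lim_1_over_n[THEN LIMSEQ_Suc] | simp)+
  have near: "(norm (x n - x m))\<^sup>2 \<le> E n" if "n \<le> m" for n m
  proof -
    have "(1/2) *\<^sub>R x n + (1/2) *\<^sub>R x m \<in> C n"
      using x(1) mono[OF that] by (intro convexD[OF conv]) auto
    then have "d n \<le> norm ((1/2) *\<^sub>R x n + (1/2) *\<^sub>R x m)" by (rule d_le)
    then have mid: "(d n)\<^sup>2 \<le> (norm ((1/2) *\<^sub>R x n + (1/2) *\<^sub>R x m))\<^sup>2"
      using d0 by (intro power_mono) auto
    have "norm (x n) \<le> l + 1 / Suc n" using x(2)[of n] dl[of n] by linarith
    then have n: "(norm (x n))\<^sup>2 \<le> (l + 1 / Suc n)\<^sup>2" by (intro power_mono) auto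
    have "1 / Suc m \<le> (1::real) / Suc n" using that by (intro divide_left_mono) auto
    then have "norm (x m) \<le> l + 1 / Suc n" using x(2)[of m] dl[of m] by linarith
    then have m: "(norm (x m))\<^sup>2 \<le> (l + 1 / Suc n)\<^sup>2" by (intro power_mono) auto
    have "(norm (x n - x m))\<^sup>2 = 2 * (norm (x n))\<^sup>2 + 2 * (norm (x m))\<^sup>2
        - 4 * (norm ((1/2) *\<^sub>R x n + (1/2) *\<^sub>R x m))\<^sup>2"
      unfolding power2_norm_eq_inner by (simp add: algebra_simps inner_commute)
    then show ?thesis using mid n m unfolding E_def by linarith
  qed
  have "Cauchy x"
  proof (rule metric_CauchyI)
    fix \<epsilon> :: real
    assume \<epsilon>: "0 < \<epsilon>"
    then have "\<forall>\<^sub>F n in sequentially. E n < (\<epsilon> / 2)\<^sup>2"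
      by (intro order_tendstoD[OF E]) auto
    then obtain N where N: "E N < (\<epsilon> / 2)\<^sup>2" unfolding eventually_sequentially by auto
    have *: "norm (x N - x m) < \<epsilon> / 2" if "N \<le> m" for m
      using near[OF that] N \<epsilon> by (intro power2_less_imp_less[of _ "\<epsilon> / 2"]) auto
    show "\<exists>M. \<forall>m\<ge>M. \<forall>n\<ge>M. dist (x m) (x n) < \<epsilon>"
    proof (intro exI allI impI)
      fix m n
      assume "N \<le> m" "N \<le> n"
      then show "dist (x m) (x n) < \<epsilon>"
        using *[of m] *[of n] dist_triangle_half_r[of "x N" "x m" \<epsilon> "x n"] by (simp add: dist_norm)
    qed
  qed
  then obtain p where p: "x \<longlonglongrightarrow> p" using Cauchy_convergent_iff convergent_def by blast
  have "p \<in> C n" for n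
  proof (rule Lim_in_closed_set[OF closed _ _ p])
    show "\<forall>\<^sub>F m in sequentially. x m \<in> C n"
      using x(1) mono unfolding eventually_sequentially by blast
  qed simp
  then show ?thesis unfolding tail_hull_def C_def by auto
qed

text \<open>Since the tail hull replaces the set of weak cluster points, no weak compactness is needed.\<close>

lemma weakly_converges_in_tail_hull:
  fixes w :: "nat \<Rightarrow> 'a::{real_inner, complete_space}"
  assumes bdd: "bounded (range w)"
    and dist: "\<And>z. z \<in> tail_hull w \<Longrightarrow> convergent (\<lambda>n. norm (w n - z))"
  shows "\<exists>x \<in> tail_hull w. weakly_converges w x"
proof -
  \<comment> \<open>Opial's cancellation: the difference of the squared distances to
    \<open>x\<close> and \<open>y\<close> is affine in \<open>w n\<close>, so
    \<open>(x - y) \<bullet> w n\<close> converges. Its limit fixes a hyperplane that contains the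
    whole tail hull, in particular \<open>x\<close> and \<open>y\<close>.\<close>
  have uniq: "x = y" if x: "x \<in> tail_hull w" and y: "y \<in> tail_hull w" for x y
  proof -
    obtain a c where "(\<lambda>n. norm (w n - x)) \<longlonglongrightarrow> a" "(\<lambda>n. norm (w n - y)) \<longlonglongrightarrow> c"
      using dist[OF x] dist[OF y] unfolding convergent_def by blast
    then have "(\<lambda>n. ((norm (w n - y))\<^sup>2 - (norm (w n - x))\<^sup>2 + (norm x)\<^sup>2 - (norm y)\<^sup>2) / 2)
        \<longlonglongrightarrow> (c\<^sup>2 - a\<^sup>2 + (norm x)\<^sup>2 - (norm y)\<^sup>2) / 2"
      by (intro tendsto_intros) auto
    moreover have "((norm (w n - y))\<^sup>2 - (norm (w n - x))\<^sup>2 + (norm x)\<^sup>2 - (norm y)\<^sup>2) / 2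
        = (x - y) \<bullet> w n" for n
      unfolding power2_norm_eq_inner by (simp add: algebra_simps inner_commute diff_divide_distrib)
    ultimately obtain l where lim: "(\<lambda>n. (x - y) \<bullet> w n) \<longlonglongrightarrow> l" by auto
    have "(x - y) \<bullet> p = l" if p: "p \<in> tail_hull w" for p
    proof (rule antisym; rule field_le_epsilon)
      fix \<epsilon> :: real
      assume "0 < \<epsilon>"
      then have "\<forall>\<^sub>F n in sequentially. (x - y) \<bullet> w n < l + \<epsilon>"
        "\<forall>\<^sub>F n in sequentially. (x - y) \<bullet> w n > l - \<epsilon>"
        by (intro order_tendstoD[OF lim]; simp)+
      then have "\<forall>\<^sub>F n in sequentially. w n \<in> {p. (x - y) \<bullet> p \<le> l + \<epsilon>}"
        "\<forall>\<^sub>F n in sequentially. w n \<in> {p. (x - y) \<bullet> p \<ge> l - \<epsilon>}"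
        by (auto elim: eventually_mono)
      from tail_hull_subset[OF closed_halfspace_le convex_halfspace_le this(1)]
        tail_hull_subset[OF closed_halfspace_ge convex_halfspace_ge this(2)]
      show "(x - y) \<bullet> p \<le> l + \<epsilon>" "l \<le> (x - y) \<bullet> p + \<epsilon>" using p by auto
    qed
    from this[OF x] this[OF y] have "(x - y) \<bullet> (x - y) = 0" by (simp add: inner_diff_right)
    then show ?thesis by simp
  qed
  obtain x where x: "x \<in> tail_hull w" using tail_hull_nonempty[OF bdd] by blast
  have upper: "\<forall>\<^sub>F n in sequentially. y \<bullet> w n < y \<bullet> x + \<epsilon>" if "0 < \<epsilon>" for y \<epsilon>
  proof (rule ccontr)
    assume "\<not> ?thesis"
    then have "\<exists>\<^sub>F n in sequentially. y \<bullet> w n \<ge> y \<bullet> x + \<epsilon>"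
      by (simp add: frequently_def not_le)
    then have inf: "infinite {n. y \<bullet> w n \<ge> y \<bullet> x + \<epsilon>}"
      by (simp add: frequently_cofinite cofinite_eq_sequentially[symmetric])
    \<comment> \<open>The subsequence of failures has a tail hull point of its own. It must be
      \<open>x\<close>, yet it lies in a half-space that excludes \<open>x\<close>.\<close>
    define r where "r = enumerate {n. y \<bullet> w n \<ge> y \<bullet> x + \<epsilon>}"
    have r: "strict_mono r" "\<And>n. y \<bullet> w (r n) \<ge> y \<bullet> x + \<epsilon>"
      using strict_mono_enumerate[OF inf] enumerate_in_set[OF inf] unfolding r_def by auto
    have "bounded (range (w \<circ> r))" by (rule bounded_subset[OF bdd]) auto
    then obtain p where p: "p \<in> tail_hull (w \<circ> r)" using tail_hull_nonempty by blast
    then have "p = x" using tail_hull_subseq[OF r(1)] uniq x by blast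
    moreover have "p \<in> {p. y \<bullet> p \<ge> y \<bullet> x + \<epsilon>}"
      by (rule subsetD[OF tail_hull_subset p])
         (auto simp: r closed_halfspace_ge convex_halfspace_ge)
    ultimately show False using that by simp
  qed
  have "(\<lambda>n. w n \<bullet> y) \<longlonglongrightarrow> x \<bullet> y" for y
  proof (rule order_tendstoI)
    fix a
    assume "a < x \<bullet> y"
    then show "\<forall>\<^sub>F n in sequentially. a < w n \<bullet> y"
      using upper[of "x \<bullet> y - a" "- y"] by (simp add: inner_commute algebra_simps)
  next
    fix a
    assume "x \<bullet> y < a"
    then show "\<forall>\<^sub>F n in sequentially. w n \<bullet> y < a"
      using upper[of "a - x \<bullet> y" y] by (simp add: inner_commute)
  qed
  then show ?thesis using x unfolding weakly_converges_def by blast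
qed

section \<open>Quasi-decreasing sequences\<close>

lemma summable_of_telescoping_bound:
  fixes a s \<epsilon> :: "nat \<Rightarrow> real"
  assumes a: "\<And>n. 0 \<le> a n" and s: "\<And>n. 0 \<le> s n" and \<epsilon>: "\<And>n. 0 \<le> \<epsilon> n" "summable \<epsilon>"
    and step: "\<And>n. a (Suc n) + s n \<le> a n + \<epsilon> n"
  shows "summable s"
proof (rule summableI_nonneg_bounded[OF s])
  fix n
  have "a n + sum s {..<n} \<le> a 0 + sum \<epsilon> {..<n}"
  proof (induction n)
    case (Suc n)
    then show ?case using step[of n] by simp
  qed simp
  moreover have "sum \<epsilon> {..<n} \<le> suminf \<epsilon>" using \<epsilon> by (intro sum_le_suminf) auto
  ultimately show "sum s {..<n} \<le> a 0 + suminf \<epsilon>" using a[of n] by linarith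
qed

text \<open>Subtracting the accumulated errors leaves a decreasing sequence that is still bounded
  below.\<close>

lemma quasi_decreasing_convergent:
  fixes a \<epsilon> :: "nat \<Rightarrow> real"
  assumes a: "\<And>n. 0 \<le> a n" and \<epsilon>: "\<And>n. 0 \<le> \<epsilon> n" "summable \<epsilon>"
    and step: "\<And>n. a (Suc n) \<le> a n + \<epsilon> n"
  shows "convergent a"
proof -
  define s where "s n = a n - sum \<epsilon> {..<n}" for n
  have "decseq s" unfolding s_def using step by (intro decseq_SucI) (simp add: algebra_simps)
  moreover have "\<forall>n. - suminf \<epsilon> \<le> s n"
  proof
    fix n
    show "- suminf \<epsilon> \<le> s n"
      using sum_le_suminf[of \<epsilon> "{..<n}"] \<epsilon> a[of n] unfolding s_def by simp
  qed
  ultimately obtain l where "s \<longlonglongrightarrow> l" by (rule decseq_convergent)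
  then have "(\<lambda>n. s n + sum \<epsilon> {..<n}) \<longlonglongrightarrow> l + suminf \<epsilon>"
    using \<epsilon> by (intro tendsto_add summable_LIMSEQ)
  then show ?thesis unfolding s_def by (simp add: convergent_def) blast
qed

text \<open>The sequence \<open>n * h n\<close> is quasi-decreasing, so it converges, and its limit vanishes because
  the harmonic series diverges.\<close>

lemma quasi_decreasing_summable_rate:
  fixes h \<epsilon> :: "nat \<Rightarrow> real"
  assumes h: "\<And>n. 0 \<le> h n" "summable h"
    and \<epsilon>: "\<And>n. 0 \<le> \<epsilon> n" "summable (\<lambda>n. real n * \<epsilon> n)"
    and step: "\<And>n. h (Suc n) \<le> h n + \<epsilon> n"
  shows "(\<lambda>n. real n * h n) \<longlonglongrightarrow> 0"
proof -
  have "convergent (\<lambda>n. real n * h n)"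
  proof (rule quasi_decreasing_convergent)
    \<comment> \<open>Raising the weight from \<open>n\<close> to \<open>n + 1\<close> costs one
      extra \<open>h (Suc n)\<close>, which the summability of \<open>h\<close> pays for.\<close>
    show "summable (\<lambda>n. h (Suc n) + real n * \<epsilon> n)"
      using h \<epsilon> by (intro summable_add) (simp_all add: summable_Suc_iff)
    show "real (Suc n) * h (Suc n) \<le> real n * h n + (h (Suc n) + real n * \<epsilon> n)" for n
      using mult_left_mono[OF step, of "real n" n] by (simp add: algebra_simps)
  qed (use h \<epsilon> in auto)
  then obtain l where l: "(\<lambda>n. real n * h n) \<longlonglongrightarrow> l" unfolding convergent_def by blast
  have "0 \<le> l" by (rule LIMSEQ_le_const[OF l]) (use h in auto)
  moreover have "\<not> 0 < l"
  proof
    assume "0 < l"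
    then have "\<forall>\<^sub>F n in sequentially. l / 2 < real n * h n" by (intro order_tendstoD[OF l]) simp
    then have "\<forall>\<^sub>F n in sequentially. norm (l / 2 * inverse (real n)) \<le> h n"
      using eventually_gt_at_top[of 0]
      by eventually_elim (use \<open>0 < l\<close> in \<open>simp add: field_simps\<close>)
    then have "summable (\<lambda>n. l / 2 * inverse (real n))"
      using h(2) by (rule summable_comparison_test_ev)
    then have "summable (\<lambda>n. inverse (real n))"
      using \<open>0 < l\<close> by (subst (asm) summable_cmult_iff) auto
    then show False using not_summable_harmonic[where 'a = real] by simp
  qed
  ultimately show ?thesis using l by simp
qed

lemma summable_square:
  fixes a :: "nat \<Rightarrow> real"
  assumes "\<And>n. 0 \<le> a n" "summable a"
  shows "summable (\<lambda>n. (a n)\<^sup>2)"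
proof -
  have "bounded (range a)" using summable_LIMSEQ_zero[OF assms(2)] by (rule convergent_imp_bounded)
  then obtain B where B: "\<And>n. norm (a n) \<le> B" unfolding bounded_iff by auto
  show ?thesis
  proof (rule summable_comparison_test'[where g = "\<lambda>n. B * a n"])
    show "norm ((a n)\<^sup>2) \<le> B * a n" for n
      using B[of n] assms(1)[of n] by (simp add: power2_eq_square mult_right_mono)
  qed (intro summable_mult assms)
qed

lemma summable_square_sum:
  fixes a b :: "nat \<Rightarrow> real"
  assumes "summable (\<lambda>n. (a n)\<^sup>2)" "summable (\<lambda>n. (b n)\<^sup>2)"
  shows "summable (\<lambda>n. (a n + b n)\<^sup>2)"
proof (rule summable_comparison_test'[where g = "\<lambda>n. 2 * (a n)\<^sup>2 + 2 * (b n)\<^sup>2"])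
  show "summable (\<lambda>n. 2 * (a n)\<^sup>2 + 2 * (b n)\<^sup>2)"
    using assms by (intro summable_add summable_mult)
  show "norm ((a n + b n)\<^sup>2) \<le> 2 * (a n)\<^sup>2 + 2 * (b n)\<^sup>2" for n
  proof -
    have "norm ((a n + b n)\<^sup>2) = (a n + b n)\<^sup>2" by simp
    then show ?thesis using sum_squares_bound[of "a n" "b n"] by (simp add: power2_sum)
  qed
qed

section \<open>The perturbed forward-backward iteration\<close>

text \<open>In the application \<open>a\<close> is the length of \<open>v m - u m\<close> and
  \<open>d\<close> that of the gradient difference. For fixed positive \<open>\<gamma>\<close> the
  form has determinant \<open>2 * \<gamma> / \<beta> - \<gamma>\<^sup>2\<close>, positive exactly
  for \<open>\<gamma> < 2 / \<beta>\<close>; the bounds on \<open>\<gamma>\<close> make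
  \<open>c\<close> uniform.\<close>

lemma quadratic_form_coercive:
  fixes \<beta> \<gamma>0 \<gamma>1 :: real
  assumes "0 < \<beta>" "0 < \<gamma>0" "\<gamma>1 < 2 / \<beta>" "\<gamma>0 \<le> \<gamma>1"
  obtains c where "0 < c" "\<And>\<gamma> a d. \<gamma>0 \<le> \<gamma> \<Longrightarrow> \<gamma> \<le> \<gamma>1 \<Longrightarrow>
    c * (a\<^sup>2 + d\<^sup>2) \<le> a\<^sup>2 - 2 * (\<gamma> * (a * d)) + 2 * (\<gamma> * (d\<^sup>2 / \<beta>))"
proof -
  \<comment> \<open>The midpoint of \<open>\<gamma>1 * \<beta> / 2\<close> and 1. Young's inequality
    spends the share \<open>l\<close> of \<open>a\<^sup>2\<close> on the cross term;
    \<open>l < 1\<close> leaves some of \<open>a\<^sup>2\<close>, and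
    \<open>l > \<gamma>1 * \<beta> / 2\<close> leaves some of \<open>d\<^sup>2\<close>.\<close>
  define l where "l = (1 + \<gamma>1 * \<beta> / 2) / 2"
  have 1: "\<gamma>1 * \<beta> / 2 < l" "l < 1" using assms by (auto simp: l_def field_simps)
  moreover have "0 < \<gamma>1 * \<beta>" using assms by simp
  ultimately have l: "0 < l" by linarith
  define k where "k = 2 / \<beta> - \<gamma>1 / l"
  have k: "0 < k" using 1 l assms by (simp add: k_def field_simps)
  define c where "c = min (1 - l) (\<gamma>0 * k)"
  show thesis
  proof (rule that[of c])
    show "0 < c" using 1 k assms by (simp add: c_def)
    fix \<gamma> a d :: real
    assume \<gamma>: "\<gamma>0 \<le> \<gamma>" "\<gamma> \<le> \<gamma>1"
    have "0 \<le> (l * a - \<gamma> * d)\<^sup>2 / l" using l by simp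
    also have "\<dots> = l * a\<^sup>2 - 2 * \<gamma> * (a * d) + \<gamma>\<^sup>2 / l * d\<^sup>2"
      using l by (simp add: power2_eq_square field_simps)
    finally have young: "2 * (\<gamma> * (a * d)) \<le> l * a\<^sup>2 + \<gamma>\<^sup>2 / l * d\<^sup>2" by simp
    have "c * (a\<^sup>2 + d\<^sup>2) = c * a\<^sup>2 + c * d\<^sup>2" by (rule distrib_left)
    also have "\<dots> \<le> (1 - l) * a\<^sup>2 + (2 * \<gamma> / \<beta> - \<gamma>\<^sup>2 / l) * d\<^sup>2"
    proof (intro add_mono mult_right_mono)
      have "c \<le> \<gamma>0 * k" by (simp add: c_def)
      also have "\<dots> \<le> \<gamma> * (2 / \<beta> - \<gamma> / l)"
        using \<gamma> k l assms unfolding k_def by (intro mult_mono) (auto intro: divide_right_mono)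
      also have "\<dots> = 2 * \<gamma> / \<beta> - \<gamma>\<^sup>2 / l" by (simp add: power2_eq_square right_diff_distrib)
      finally show "c \<le> 2 * \<gamma> / \<beta> - \<gamma>\<^sup>2 / l" .
    qed (auto simp: c_def)
    also have "\<dots> = a\<^sup>2 - (l * a\<^sup>2 + \<gamma>\<^sup>2 / l * d\<^sup>2) + 2 * (\<gamma> * (d\<^sup>2 / \<beta>))"
      by (simp add: left_diff_distrib)
    also have "\<dots> \<le> a\<^sup>2 - 2 * (\<gamma> * (a * d)) + 2 * (\<gamma> * (d\<^sup>2 / \<beta>))"
      using young by (intro add_mono diff_mono) auto
    finally show "c * (a\<^sup>2 + d\<^sup>2) \<le> a\<^sup>2 - 2 * (\<gamma> * (a * d)) + 2 * (\<gamma> * (d\<^sup>2 / \<beta>))" .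
  qed
qed

lemma inner_three_points:
  fixes x v u :: "'a::real_inner"
  shows "2 * ((x - v) \<bullet> (v - u)) = (norm (u - x))\<^sup>2 - (norm (v - x))\<^sup>2 - (norm (v - u))\<^sup>2"
  unfolding power2_norm_eq_inner by (simp add: algebra_simps inner_commute)

lemma error_term_le:
  fixes e M n :: real
  assumes "0 \<le> e" "n \<le> M" "e \<le> M"
  shows "2 * e * n + 2 * e\<^sup>2 \<le> 4 * M * e"
proof -
  have "e * (n + e) \<le> e * (M + M)" using assms by (intro mult_left_mono add_mono) auto
  then show ?thesis by (simp add: power2_eq_square algebra_simps)
qed

text \<open>What remains of the iteration once extended values are gone: \<open>v_step\<close> is
  the only trace of the proximal step, and \<open>sublevel_closed\<close> the only trace of lower
  semicontinuity.\<close>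

locale forward_backward =
  fixes F g :: "'a::{real_inner, complete_space} \<Rightarrow> real" and gradF :: "'a \<Rightarrow> 'a" and D :: "'a set"
    and \<beta> \<gamma>0 \<gamma>1 \<tau>0 :: real and \<gamma> \<tau> e :: "nat \<Rightarrow> real" and u v :: "nat \<Rightarrow> 'a"
  assumes F_convex: "convex_on UNIV F"
    and F_grad: "\<And>x. GDERIV F x :> gradF x"
    and beta_pos: "0 < \<beta>"
    and grad_lipschitz: "\<beta>-lipschitz_on UNIV gradF"
    and g_convex: "convex_on D g"
    and sublevel_closed: "\<And>c. closed {z \<in> D. F z + g z \<le> c}"
    and gamma_bounds: "0 < \<gamma>0" "\<And>m. \<gamma>0 \<le> \<gamma> m" "\<And>m. \<gamma> m \<le> \<gamma>1" "\<gamma>1 < 2 / \<beta>"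
    and tau_bounds: "0 < \<tau>0" "\<And>m. \<tau>0 \<le> \<tau> m" "\<And>m. \<tau> m \<le> 1"
    and e_nonneg: "\<And>m. 0 \<le> e m"
    and e_summable: "summable e"
    and v_in: "\<And>m. v m \<in> D"
    and v_step: "\<And>m z. z \<in> D \<Longrightarrow> \<gamma> m * (g (v m) - g z) \<le>
      (z - v m) \<bullet> (v m - u m) + \<gamma> m * ((z - v m) \<bullet> gradF (u m)) + e m * norm (z - v m) + (e m)\<^sup>2"
    and u_step: "\<And>m. u (Suc m) = u m + \<tau> m *\<^sub>R (v m - u m)"
begin

definition h :: "'a \<Rightarrow> real" where "h z = F z + g z"

definition minimizer :: "'a \<Rightarrow> bool" where
  "minimizer x \<longleftrightarrow> x \<in> D \<and> (\<forall>z\<in>D. h x \<le> h z)"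

lemmas descent = lipschitz_gradient_descent[OF F_grad grad_lipschitz]
lemmas gradient_le = convex_gradient_inequality[OF F_grad grad_lipschitz F_convex]
lemmas cocoercive = gradient_cocoercive[OF F_grad grad_lipschitz F_convex beta_pos]

lemma gamma_pos: "0 < \<gamma> m" using gamma_bounds(1) gamma_bounds(2)[of m] by linarith
lemma tau_pos: "0 < \<tau> m" using tau_bounds(1) tau_bounds(2)[of m] by linarith

lemma gamma_beta_le: "\<gamma> m * \<beta> \<le> 2"
proof -
  have "\<gamma> m * \<beta> \<le> \<gamma>1 * \<beta>" using gamma_bounds(3) beta_pos by (intro mult_right_mono) auto
  also have "\<dots> < 2" using gamma_bounds(4) beta_pos by (simp add: field_simps)
  finally show ?thesis by simp
qed

lemma u_Suc: "u (Suc m) = (1 - \<tau> m) *\<^sub>R u m + \<tau> m *\<^sub>R v m"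
  by (simp add: u_step algebra_simps)

section \<open>Quasi-Fejer estimates for the distance to a minimizer\<close>

text \<open>Fermat's rule: \<open>- gradF x\<close> is a subgradient of \<open>g\<close> at
  \<open>x\<close>. On the segment towards \<open>z\<close>, convexity controls \<open>g\<close> and
  the descent lemma expands \<open>F\<close>.\<close>

lemma minimizer_subgradient:
  assumes x: "minimizer x" and z: "z \<in> D"
  shows "g x - g z \<le> gradF x \<bullet> (z - x)"
proof (rule le_of_le_add_small_multiple)
  fix t :: real
  assume t: "0 < t" "t < 1"
  define y where "y = (1 - t) *\<^sub>R x + t *\<^sub>R z"
  have xD: "x \<in> D" using x by (simp add: minimizer_def)
  have "y \<in> D"
    unfolding y_def using convex_on_imp_convex[OF g_convex] xD z t by (intro convexD) auto
  then have "F x + g x \<le> F y + g y" using x by (simp add: minimizer_def h_def)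
  moreover have "g y \<le> (1 - t) * g x + t * g z"
    unfolding y_def using t xD z by (intro convex_onD[OF g_convex]) auto
  moreover have "F y \<le> F x + t * (gradF x \<bullet> (z - x)) + \<beta> / 2 * (t * (t * (norm (z - x))\<^sup>2))"
  proof -
    have "y - x = t *\<^sub>R (z - x)" by (simp add: y_def algebra_simps)
    then show ?thesis using descent[of y x] by (simp add: power_mult_distrib power2_eq_square[of t] mult.assoc)
  qed
  ultimately have "t * (g x - g z) \<le> t * (gradF x \<bullet> (z - x) + t * (\<beta> / 2 * (norm (z - x))\<^sup>2))"
    by (simp add: algebra_simps)
  then show "g x - g z \<le> gradF x \<bullet> (z - x) + t * (\<beta> / 2 * (norm (z - x))\<^sup>2)"
    using t by simp
qed

text \<open>Optimality of \<open>x\<close> turns \<open>gradF (u m)\<close> in \<open>v_step\<close>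
  into the difference \<open>d\<close>. Splitting \<open>x - v m\<close> at \<open>u m\<close>,
  cocoercivity yields the negative square of \<open>d\<close> and Cauchy-Schwarz the cross term,
  which together with the square from \<open>inner_three_points\<close> form the coercive quadratic
  form.\<close>

lemma fejer_inequality:
  assumes x: "minimizer x"
  shows "\<exists>c>0. \<forall>m. (norm (v m - x))\<^sup>2 + c * ((norm (v m - u m))\<^sup>2 + (norm (gradF (u m) - gradF x))\<^sup>2)
      \<le> (norm (u m - x))\<^sup>2 + 2 * e m * norm (v m - x) + 2 * (e m)\<^sup>2"
proof -
  have "\<gamma>0 \<le> \<gamma>1" using gamma_bounds(2,3) order_trans by blast
  from quadratic_form_coercive[OF beta_pos gamma_bounds(1,4) this]
  obtain c where c: "0 < c" "\<And>\<gamma> a d. \<gamma>0 \<le> \<gamma> \<Longrightarrow> \<gamma> \<le> \<gamma>1 \<Longrightarrow>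
    c * (a\<^sup>2 + d\<^sup>2) \<le> a\<^sup>2 - 2 * (\<gamma> * (a * d)) + 2 * (\<gamma> * (d\<^sup>2 / \<beta>))" by blast
  show ?thesis
  proof (intro exI conjI allI)
    show "0 < c" by (rule c(1))
    fix m
    define d where "d = gradF (u m) - gradF x"
    have "g (v m) - g x \<ge> - (gradF x \<bullet> (v m - x))"
      using minimizer_subgradient[OF x v_in, of m] by simp
    then have "\<gamma> m * (- (gradF x \<bullet> (v m - x))) \<le> \<gamma> m * (g (v m) - g x)"
      using gamma_pos[of m] by (intro mult_left_mono) auto
    also have "\<dots> \<le> (x - v m) \<bullet> (v m - u m) + \<gamma> m * ((x - v m) \<bullet> gradF (u m))
        + e m * norm (x - v m) + (e m)\<^sup>2"
      using x by (intro v_step) (simp add: minimizer_def)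
    finally have subgrad: "0 \<le> (x - v m) \<bullet> (v m - u m) + \<gamma> m * ((x - v m) \<bullet> d) + e m * norm (v m - x) + (e m)\<^sup>2"
      unfolding d_def by (simp add: algebra_simps inner_commute norm_minus_commute)
    have "(x - v m) \<bullet> d \<le> norm (v m - u m) * norm d - (norm d)\<^sup>2 / \<beta>"
    proof -
      have "(x - v m) \<bullet> d = d \<bullet> (u m - v m) - d \<bullet> (u m - x)"
        by (simp add: algebra_simps inner_commute)
      moreover have "d \<bullet> (u m - v m) \<le> norm (v m - u m) * norm d"
        using norm_cauchy_schwarz[of d "u m - v m"] by (simp add: norm_minus_commute mult.commute)
      ultimately show ?thesis using cocoercive[of "u m" x] unfolding d_def by linarith
    qed
    then have "\<gamma> m * ((x - v m) \<bullet> d) \<le> \<gamma> m * (norm (v m - u m) * norm d - (norm d)\<^sup>2 / \<beta>)"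
      using gamma_pos[of m] by (intro mult_left_mono) auto
    then have grad: "\<gamma> m * ((x - v m) \<bullet> d)
        \<le> \<gamma> m * (norm (v m - u m) * norm d) - \<gamma> m * ((norm d)\<^sup>2 / \<beta>)"
      by (simp only: right_diff_distrib)
    \<comment> \<open>With each product as one unknown only linear arithmetic remains:
      \<open>X\<close> and \<open>Y\<close> are the two inner products, \<open>N\<close> the cross
      term and \<open>Q\<close> the gain from cocoercivity.\<close>
    have combine: "V + C \<le> U + 2 * E + 2 * S"
      if "0 \<le> X + Y + E + S" "Y \<le> N - Q" "2 * X = U - V - W" "C \<le> W - 2 * N + 2 * Q"
      for V C U E S X Y N Q W :: real
      using that by linarith
    show "(norm (v m - x))\<^sup>2 + c * ((norm (v m - u m))\<^sup>2 + (norm (gradF (u m) - gradF x))\<^sup>2)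
      \<le> (norm (u m - x))\<^sup>2 + 2 * e m * norm (v m - x) + 2 * (e m)\<^sup>2"
      using combine[OF subgrad grad inner_three_points c(2)[OF gamma_bounds(2,3)]]
      by (simp only: d_def mult.assoc)
  qed
qed

text \<open>The Fejer error contains the distance to be bounded. Completing the square gives
  \<open>(norm (v m - x) - e m)\<^sup>2 \<le> (norm (u m - x))\<^sup>2 + 3 * (e m)\<^sup>2\<close>,
  and the right side is at most \<open>(norm (u m - x) + 2 * e m)\<^sup>2\<close>.\<close>

lemma norm_v_le:
  assumes x: "minimizer x"
  shows "norm (v m - x) \<le> norm (u m - x) + 3 * e m"
proof -
  obtain c where c: "0 < c" and *: "\<forall>m. (norm (v m - x))\<^sup>2 + c * ((norm (v m - u m))\<^sup>2 + (norm (gradF (u m) - gradF x))\<^sup>2)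
      \<le> (norm (u m - x))\<^sup>2 + 2 * e m * norm (v m - x) + 2 * (e m)\<^sup>2"
    using fejer_inequality[OF x] by (elim exE conjE) (rule that)
  have "0 \<le> c * ((norm (v m - u m))\<^sup>2 + (norm (gradF (u m) - gradF x))\<^sup>2)" using c by simp
  moreover have "(norm (v m - x) - e m)\<^sup>2 = (norm (v m - x))\<^sup>2 + (e m)\<^sup>2 - 2 * e m * norm (v m - x)"
    by (simp add: power2_diff)
  ultimately have "(norm (v m - x) - e m)\<^sup>2 \<le> (norm (u m - x))\<^sup>2 + 3 * (e m)\<^sup>2"
    using *[rule_format, of m] by linarith
  also have "\<dots> \<le> (norm (u m - x) + 2 * e m)\<^sup>2"
    using e_nonneg[of m] by (simp add: power2_sum power_mult_distrib)
  finally have "norm (v m - x) - e m \<le> norm (u m - x) + 2 * e m"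
    by (rule power2_le_imp_le) (use e_nonneg[of m] in auto)
  then show ?thesis by simp
qed

lemma norm_u_Suc_le: "norm (u (Suc m) - x) \<le> (1 - \<tau> m) * norm (u m - x) + \<tau> m * norm (v m - x)"
proof -
  have "u (Suc m) - x = (1 - \<tau> m) *\<^sub>R (u m - x) + \<tau> m *\<^sub>R (v m - x)"
    by (simp add: u_Suc algebra_simps)
  also have "norm \<dots> \<le> norm ((1 - \<tau> m) *\<^sub>R (u m - x)) + norm (\<tau> m *\<^sub>R (v m - x))"
    by (rule norm_triangle_ineq)
  finally show ?thesis using tau_pos[of m] tau_bounds(3)[of m] by simp
qed

lemma norm_u_Suc_square_le:
  "(norm (u (Suc m) - x))\<^sup>2 \<le> (1 - \<tau> m) * (norm (u m - x))\<^sup>2 + \<tau> m * (norm (v m - x))\<^sup>2"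
proof -
  have "(norm (u (Suc m) - x))\<^sup>2 \<le> ((1 - \<tau> m) * norm (u m - x) + \<tau> m * norm (v m - x))\<^sup>2"
    by (intro power_mono norm_u_Suc_le) auto
  also have "\<dots> \<le> (1 - \<tau> m) * (norm (u m - x))\<^sup>2 + \<tau> m * (norm (v m - x))\<^sup>2"
    using tau_pos[of m] tau_bounds(3)[of m]
    using convex_onD[OF convex_power2, of "\<tau> m" "norm (u m - x)" "norm (v m - x)"] by simp
  finally show ?thesis .
qed

lemma norm_u_convergent:
  assumes x: "minimizer x"
  shows "convergent (\<lambda>m. norm (u m - x))"
proof (rule quasi_decreasing_convergent)
  show "norm (u (Suc m) - x) \<le> norm (u m - x) + 3 * e m" for m
  proof -
    have "norm (u (Suc m) - x) \<le> (1 - \<tau> m) * norm (u m - x) + \<tau> m * norm (v m - x)"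
      by (rule norm_u_Suc_le)
    also have "\<dots> \<le> (1 - \<tau> m) * norm (u m - x) + \<tau> m * (norm (u m - x) + 3 * e m)"
      using norm_v_le[OF x] tau_pos[of m] by (intro add_left_mono mult_left_mono) auto
    also have "\<dots> = norm (u m - x) + \<tau> m * (3 * e m)" by (simp add: algebra_simps)
    also have "\<dots> \<le> norm (u m - x) + 3 * e m"
      using tau_bounds(3)[of m] e_nonneg[of m] by (simp add: mult_left_le_one_le tau_pos less_imp_le)
    finally show ?thesis .
  qed
qed (use e_nonneg e_summable in \<open>auto intro: summable_mult\<close>)

lemma iterates_bounded:
  assumes x: "minimizer x"
  obtains M where "0 \<le> M" "\<And>m. norm (u m - x) \<le> M" "\<And>m. norm (v m - x) \<le> M" "\<And>m. e m \<le> M"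
proof -
  have "bounded (range (\<lambda>m. norm (u m - x)))" "bounded (range e)"
    using norm_u_convergent[OF x] summable_LIMSEQ_zero[OF e_summable]
    by (auto simp: convergent_def intro: convergent_imp_bounded)
  then obtain A B where A: "\<And>m. norm (u m - x) \<le> A" and B: "\<And>m. e m \<le> B"
    unfolding bounded_iff by (auto simp: abs_le_iff)
  have "0 \<le> A" "0 \<le> B"
    using A[of 0] B[of 0] e_nonneg[of 0] norm_ge_zero[of "u 0 - x"] by linarith+
  show thesis
  proof (rule that[of "A + 3 * B"])
    fix m
    show "norm (u m - x) \<le> A + 3 * B" "e m \<le> A + 3 * B"
      using A[of m] B[of m] \<open>0 \<le> A\<close> \<open>0 \<le> B\<close> by linarith+
    show "norm (v m - x) \<le> A + 3 * B"
      using norm_v_le[OF x, of m] A[of m] B[of m] by linarith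
  qed (use \<open>0 \<le> A\<close> \<open>0 \<le> B\<close> in simp)
qed

lemma summable_residuals:
  assumes x: "minimizer x"
  shows "summable (\<lambda>m. (norm (v m - u m))\<^sup>2)"
    and "summable (\<lambda>m. (norm (gradF (u m) - gradF x))\<^sup>2)"
proof -
  obtain M where M: "0 \<le> M" "\<And>m. norm (u m - x) \<le> M" "\<And>m. norm (v m - x) \<le> M" "\<And>m. e m \<le> M"
    using iterates_bounded[OF x] by blast
  obtain c where c: "0 < c" and fejer: "\<forall>m. (norm (v m - x))\<^sup>2 + c * ((norm (v m - u m))\<^sup>2 + (norm (gradF (u m) - gradF x))\<^sup>2)
      \<le> (norm (u m - x))\<^sup>2 + 2 * e m * norm (v m - x) + 2 * (e m)\<^sup>2"
    using fejer_inequality[OF x] by (elim exE conjE) (rule that)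
  define R where "R m = (norm (v m - u m))\<^sup>2 + (norm (gradF (u m) - gradF x))\<^sup>2" for m
  \<comment> \<open>Relaxation keeps at least the share \<open>\<tau>0\<close> of the gain in the
    Fejer inequality.\<close>
  have "summable (\<lambda>m. \<tau>0 * c * R m)"
  proof (rule summable_of_telescoping_bound)
    show "(norm (u (Suc m) - x))\<^sup>2 + \<tau>0 * c * R m \<le> (norm (u m - x))\<^sup>2 + 4 * M * e m" for m
    proof -
      have cR: "0 \<le> c * R m" using c by (simp add: R_def)
      have "2 * e m * norm (v m - x) + 2 * (e m)\<^sup>2 \<le> 4 * M * e m"
        using M e_nonneg by (intro error_term_le)
      then have "(norm (v m - x))\<^sup>2 \<le> (norm (u m - x))\<^sup>2 + 4 * M * e m - c * R m"
        using fejer[rule_format, of m] unfolding R_def by linarith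
      then have "\<tau> m * (norm (v m - x))\<^sup>2 \<le> \<tau> m * ((norm (u m - x))\<^sup>2 + 4 * M * e m - c * R m)"
        using tau_pos[of m] by (intro mult_left_mono) auto
      moreover have "\<tau> m * (4 * M * e m) \<le> 4 * M * e m"
        using tau_pos[of m] tau_bounds(3)[of m] M(1) e_nonneg[of m] by (intro mult_left_le_one_le) auto
      moreover have "\<tau>0 * (c * R m) \<le> \<tau> m * (c * R m)"
        using cR tau_bounds(2) by (intro mult_right_mono) auto
      ultimately show ?thesis using norm_u_Suc_square_le[of m x] by (simp add: algebra_simps)
    qed
  qed (use M(1) c tau_bounds e_nonneg e_summable in \<open>auto simp: R_def intro!: summable_mult\<close>)
  then have R: "summable R" using c tau_bounds(1) by (simp add: mult.assoc summable_cmult_iff)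
  show "summable (\<lambda>m. (norm (v m - u m))\<^sup>2)" "summable (\<lambda>m. (norm (gradF (u m) - gradF x))\<^sup>2)"
    by (rule summable_comparison_test'[OF R]; simp add: R_def)+
qed

section \<open>Objective gaps at the points \<open>v m\<close>\<close>

text \<open>\<open>F (v m)\<close> and \<open>F x\<close> are both compared with the linearization
  at \<open>u m\<close>, so the gradient terms cancel against \<open>v_step\<close>. The coefficient
  of \<open>(norm (v m - u m))\<^sup>2\<close> is then \<open>\<gamma> m * \<beta> - 1\<close>, at
  most 1.\<close>

lemma objective_v_le:
  assumes x: "minimizer x"
  shows "2 * \<gamma> m * (h (v m) - h x) \<le> (norm (u m - x))\<^sup>2 - (norm (v m - x))\<^sup>2
    + (norm (v m - u m))\<^sup>2 + 2 * e m * norm (v m - x) + 2 * (e m)\<^sup>2"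
proof -
  have "F (v m) - F x \<le> gradF (u m) \<bullet> (v m - x) + \<beta> / 2 * (norm (v m - u m))\<^sup>2"
    using descent[of "v m" "u m"] gradient_le[of "u m" x] by (simp add: inner_diff_right)
  then have "\<gamma> m * (F (v m) - F x) \<le> \<gamma> m * (gradF (u m) \<bullet> (v m - x) + \<beta> / 2 * (norm (v m - u m))\<^sup>2)"
    using gamma_pos[of m] by (intro mult_left_mono) auto
  moreover have "\<gamma> m * (g (v m) - g x) \<le>
      (x - v m) \<bullet> (v m - u m) + \<gamma> m * ((x - v m) \<bullet> gradF (u m)) + e m * norm (x - v m) + (e m)\<^sup>2"
    using x by (intro v_step) (simp add: minimizer_def)
  moreover have "\<gamma> m * \<beta> * (norm (v m - u m))\<^sup>2 \<le> 2 * (norm (v m - u m))\<^sup>2"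
    by (intro mult_right_mono gamma_beta_le) auto
  moreover note inner_three_points[of x "v m" "u m"]
  ultimately show ?thesis
    unfolding h_def by (simp add: algebra_simps inner_commute norm_minus_commute)
qed

lemma objective_v_nonneg: "minimizer x \<Longrightarrow> 0 \<le> h (v m) - h x"
  using v_in by (simp add: minimizer_def)

text \<open>The difference of squared distances is factored rather than telescoped, which bounds the
  gap by a multiple of \<open>norm (v m - u m) + e m\<close>, a sum of two square summable
  sequences.\<close>

lemma summable_objective_v_square:
  assumes x: "minimizer x"
  shows "summable (\<lambda>m. (h (v m) - h x)\<^sup>2)"
proof -
  obtain M where M: "0 \<le> M" "\<And>m. norm (u m - x) \<le> M" "\<And>m. norm (v m - x) \<le> M" "\<And>m. e m \<le> M"
    using iterates_bounded[OF x] by blast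
  have le: "\<gamma>0 * (h (v m) - h x) \<le> 2 * M * (norm (v m - u m) + e m)" for m
  proof -
    have d: "norm (v m - u m) \<le> 2 * M"
      using norm_triangle_ineq4[of "v m - x" "u m - x"] M(2,3)[of m] by simp
    have "(norm (u m - x))\<^sup>2 - (norm (v m - x))\<^sup>2
        = (norm (u m - x) + norm (v m - x)) * (norm (u m - x) - norm (v m - x))"
      by (simp add: power2_eq_square algebra_simps)
    also have "\<dots> \<le> (norm (u m - x) + norm (v m - x)) * norm (v m - u m)"
      using norm_triangle_ineq2[of "u m - x" "v m - x"]
      by (intro mult_left_mono) (auto simp: norm_minus_commute)
    also have "\<dots> \<le> (M + M) * norm (v m - u m)"
      using M(2,3)[of m] by (intro mult_right_mono add_mono) auto
    finally have 1: "(norm (u m - x))\<^sup>2 - (norm (v m - x))\<^sup>2 \<le> 2 * M * norm (v m - u m)" by simp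
    have 2: "(norm (v m - u m))\<^sup>2 \<le> 2 * M * norm (v m - u m)"
      using d by (simp add: power2_eq_square mult_right_mono)
    have 3: "2 * e m * norm (v m - x) + 2 * (e m)\<^sup>2 \<le> 4 * M * e m"
      using M e_nonneg by (intro error_term_le)
    have "2 * (\<gamma>0 * (h (v m) - h x)) \<le> 2 * \<gamma> m * (h (v m) - h x)"
      using gamma_bounds(2)[of m] objective_v_nonneg[OF x, of m] by (simp add: mult_right_mono)
    then show ?thesis using 1 2 3 objective_v_le[OF x, of m] by (simp add: algebra_simps)
  qed
  show ?thesis
  proof (rule summable_comparison_test')
    show "summable (\<lambda>m. (2 * M / \<gamma>0)\<^sup>2 * (norm (v m - u m) + e m)\<^sup>2)"
      by (intro summable_mult summable_square_sum summable_residuals[OF x] summable_square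
          e_nonneg e_summable)
    show "norm ((h (v m) - h x)\<^sup>2) \<le> (2 * M / \<gamma>0)\<^sup>2 * (norm (v m - u m) + e m)\<^sup>2" for m
    proof -
      have "h (v m) - h x \<le> 2 * M / \<gamma>0 * (norm (v m - u m) + e m)"
        using le[of m] gamma_bounds(1) by (simp add: field_simps)
      then have "(h (v m) - h x)\<^sup>2 \<le> (2 * M / \<gamma>0 * (norm (v m - u m) + e m))\<^sup>2"
        using objective_v_nonneg[OF x] by (intro power_mono)
      then show ?thesis by (simp only: power_mult_distrib[of "2 * M / \<gamma>0"] real_norm_def abs_power2)
    qed
  qed
qed

text \<open>The tail hull is taken for \<open>v\<close>, which stays in \<open>D\<close> and whose
  objective gaps vanish, so closed convex sublevel sets capture its points. Since
  \<open>v m - u m\<close> tends to 0, distances and the weak limit carry over between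
  \<open>u\<close> and \<open>v\<close>.\<close>

lemma weak_convergence:
  assumes x: "minimizer x"
  shows "\<exists>p. minimizer p \<and> weakly_converges u p"
proof -
  have vu: "(\<lambda>m. v m - u m) \<longlonglongrightarrow> 0"
  proof (rule tendsto_norm_zero_cancel)
    show "(\<lambda>m. norm (v m - u m)) \<longlonglongrightarrow> 0"
      using tendsto_real_sqrt[OF summable_LIMSEQ_zero[OF summable_residuals(1)[OF x]]] by simp
  qed
  have hv: "(\<lambda>m. h (v m) - h x) \<longlonglongrightarrow> 0"
    using tendsto_real_sqrt[OF summable_LIMSEQ_zero[OF summable_objective_v_square[OF x]]]
      objective_v_nonneg[OF x] by simp
  have h_convex: "convex_on D h"
    unfolding h_def[abs_def] using convex_on_imp_convex[OF g_convex]
    by (intro convex_on_add convex_on_subset[OF F_convex] g_convex) auto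
  have cluster: "minimizer p" if p: "p \<in> tail_hull v" for p
  proof -
    have sub: "p \<in> D \<and> h p \<le> h x + \<epsilon>" if \<epsilon>: "0 < \<epsilon>" for \<epsilon>
    proof -
      have "\<forall>\<^sub>F m in sequentially. h (v m) - h x < \<epsilon>" using \<epsilon> by (intro order_tendstoD[OF hv])
      then have "\<forall>\<^sub>F m in sequentially. v m \<in> {z \<in> D. h z \<le> h x + \<epsilon>}"
        by eventually_elim (use v_in in auto)
      moreover have "convex {z \<in> D. h z \<le> h x + \<epsilon>}"
      proof (rule convexI)
        fix y z and a c :: real
        assume "y \<in> {z \<in> D. h z \<le> h x + \<epsilon>}" "z \<in> {z \<in> D. h z \<le> h x + \<epsilon>}"
          "0 \<le> a" "0 \<le> c" "a + c = 1"
        then show "a *\<^sub>R y + c *\<^sub>R z \<in> {z \<in> D. h z \<le> h x + \<epsilon>}"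
          using convexD[OF convex_on_imp_convex[OF h_convex], of y z a c]
            convex_lower[OF h_convex, of y z a c] by auto
      qed
      moreover have "closed {z \<in> D. h z \<le> h x + \<epsilon>}" unfolding h_def by (rule sublevel_closed)
      ultimately show ?thesis using tail_hull_subset p by blast
    qed
    have "h p \<le> h x"
    proof (rule field_le_epsilon)
      fix \<epsilon> :: real
      assume "0 < \<epsilon>"
      then show "h p \<le> h x + \<epsilon>" using sub by simp
    qed
    moreover have "h x \<le> h z" if "z \<in> D" for z using x that by (simp add: minimizer_def)
    ultimately show ?thesis using sub[of 1] unfolding minimizer_def by (simp add: order_trans[of "h p" "h x"])
  qed
  have "\<exists>p\<in>tail_hull v. weakly_converges v p"
  proof (rule weakly_converges_in_tail_hull)
    obtain M where M: "0 \<le> M" "\<And>m. norm (u m - x) \<le> M" "\<And>m. norm (v m - x) \<le> M" "\<And>m. e m \<le> M"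
      using iterates_bounded[OF x] by blast
    have "norm (v m) \<le> norm x + M" for m
      using norm_triangle_sub[of "v m" x] M(3)[of m] by linarith
    then show "bounded (range v)" unfolding bounded_iff by auto
    show "convergent (\<lambda>n. norm (v n - z))" if z: "z \<in> tail_hull v" for z
    proof -
      obtain a where a: "(\<lambda>m. norm (u m - z)) \<longlonglongrightarrow> a"
        using norm_u_convergent[OF cluster[OF z]] unfolding convergent_def by blast
      have "(\<lambda>m. norm (v m - z) - norm (u m - z)) \<longlonglongrightarrow> 0"
      proof (rule tendsto_0_le[OF vu, where K = 1])
        show "\<forall>\<^sub>F m in sequentially. norm (norm (v m - z) - norm (u m - z)) \<le> norm (v m - u m) * 1"
        proof (intro always_eventually allI)
          fix m
          show "norm (norm (v m - z) - norm (u m - z)) \<le> norm (v m - u m) * 1"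
            using norm_triangle_ineq3[of "v m - z" "u m - z"] by simp
        qed
      qed
      from tendsto_add[OF this a] show ?thesis unfolding convergent_def by auto
    qed
  qed
  then obtain p where p: "p \<in> tail_hull v" "weakly_converges v p" by blast
  have "(\<lambda>m. u m \<bullet> y) \<longlonglongrightarrow> p \<bullet> y" for y
  proof -
    have "(\<lambda>m. v m \<bullet> y) \<longlonglongrightarrow> p \<bullet> y"
      using p(2) unfolding weakly_converges_def by blast
    from tendsto_diff[OF this tendsto_inner[OF vu tendsto_const[of y]]]
    show ?thesis by (simp add: inner_diff_left)
  qed
  then show ?thesis using cluster[OF p(1)] unfolding weakly_converges_def by blast
qed

text \<open>To telescope, \<open>(norm (v m - x))\<^sup>2\<close> is replaced by the squared
  distance of \<open>u (Suc m)\<close>, at the price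
  \<open>M\<^sup>2 * (1 - \<tau> m)\<close>.\<close>

lemma summable_objective_v:
  assumes x: "minimizer x" and \<tau>: "summable (\<lambda>m. 1 - \<tau> m)"
  shows "summable (\<lambda>m. h (v m) - h x)"
proof -
  obtain M where M: "0 \<le> M" "\<And>m. norm (u m - x) \<le> M" "\<And>m. norm (v m - x) \<le> M" "\<And>m. e m \<le> M"
    using iterates_bounded[OF x] by blast
  have "summable (\<lambda>m. 2 * \<gamma>0 * (h (v m) - h x))"
  proof (rule summable_of_telescoping_bound)
    show "(norm (u (Suc m) - x))\<^sup>2 + 2 * \<gamma>0 * (h (v m) - h x) \<le> (norm (u m - x))\<^sup>2
      + (M\<^sup>2 * (1 - \<tau> m) + (norm (v m - u m))\<^sup>2 + 4 * M * e m)" for m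
    proof -
      have 1: "2 * e m * norm (v m - x) + 2 * (e m)\<^sup>2 \<le> 4 * M * e m"
      using M e_nonneg by (intro error_term_le)
      have 2: "2 * \<gamma>0 * (h (v m) - h x) \<le> 2 * \<gamma> m * (h (v m) - h x)"
        using gamma_bounds(2)[of m] objective_v_nonneg[OF x, of m] by (intro mult_right_mono) auto
      have "(1 - \<tau> m) * (norm (u m - x))\<^sup>2 \<le> (1 - \<tau> m) * M\<^sup>2"
        using tau_bounds(3)[of m] M(2)[of m] by (intro mult_left_mono power_mono) auto
      moreover have "\<tau> m * (norm (v m - x))\<^sup>2 \<le> (norm (v m - x))\<^sup>2"
        using tau_pos[of m] tau_bounds(3)[of m] by (intro mult_left_le_one_le) auto
      ultimately have "(norm (u (Suc m) - x))\<^sup>2 \<le> M\<^sup>2 * (1 - \<tau> m) + (norm (v m - x))\<^sup>2"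
        using norm_u_Suc_square_le[of m x] by (simp add: mult.commute)
      then show ?thesis using 1 2 objective_v_le[OF x, of m] by linarith
    qed
    show "summable (\<lambda>m. M\<^sup>2 * (1 - \<tau> m) + (norm (v m - u m))\<^sup>2 + 4 * M * e m)"
      by (intro summable_add summable_mult \<tau> summable_residuals[OF x] e_summable)
  qed (use M(1) tau_bounds(3) e_nonneg gamma_bounds(1) objective_v_nonneg[OF x] in auto)
  then show ?thesis using gamma_bounds(1) by (simp add: mult.assoc summable_cmult_iff)
qed

section \<open>Objective values along \<open>u\<close> and their rate\<close>

lemma u_in_Suc:
  assumes "u m \<in> D"
  shows "u (Suc m) \<in> D" and "h (u (Suc m)) \<le> (1 - \<tau> m) * h (u m) + \<tau> m * h (v m)"
proof -
  have \<tau>: "0 \<le> \<tau> m" "\<tau> m \<le> 1" using tau_pos[of m] tau_bounds(3)[of m] by auto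
  show "u (Suc m) \<in> D"
    unfolding u_Suc using convex_on_imp_convex[OF g_convex] assms v_in \<tau> by (intro convexD) auto
  have "g (u (Suc m)) \<le> (1 - \<tau> m) * g (u m) + \<tau> m * g (v m)"
    unfolding u_Suc using assms v_in \<tau> by (intro convex_onD[OF g_convex]) auto
  moreover have "F (u (Suc m)) \<le> (1 - \<tau> m) * F (u m) + \<tau> m * F (v m)"
    unfolding u_Suc using \<tau> by (intro convex_onD[OF F_convex]) auto
  ultimately show "h (u (Suc m)) \<le> (1 - \<tau> m) * h (u m) + \<tau> m * h (v m)"
    unfolding h_def by (simp add: algebra_simps)
qed

lemma u_in_add: "u k \<in> D \<Longrightarrow> u (m + k) \<in> D"
  by (induction m) (auto intro: u_in_Suc)

text \<open>The iterates need not lie in \<open>D\<close> before index \<open>k\<close>, so the claims on \<open>h (u m)\<close> concern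
  the shifted sequence.\<close>

lemma objective_u_tendsto:
  assumes x: "minimizer x" and k: "u k \<in> D"
  shows "(\<lambda>m. h (u (m + k)) - h x) \<longlonglongrightarrow> 0"
proof -
  define a where "a m = h (u (m + k)) - h x" for m
  define s where "s m = h (v (m + k)) - h x" for m
  have a: "0 \<le> a m" for m using x u_in_add[OF k] by (simp add: a_def minimizer_def)
  \<comment> \<open>The gaps are squared in order to draw on the square summability at
    \<open>v\<close>; convexity of the square preserves the relaxed recursion.\<close>
  have "summable (\<lambda>m. \<tau>0 * (a m)\<^sup>2)"
  proof (rule summable_of_telescoping_bound)
    show "(a (Suc m))\<^sup>2 + \<tau>0 * (a m)\<^sup>2 \<le> (a m)\<^sup>2 + (s m)\<^sup>2" for m
    proof -
      define t where "t = \<tau> (m + k)"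
      have t: "\<tau>0 \<le> t" "0 < t" "t \<le> 1" using tau_bounds tau_pos by (auto simp: t_def)
      have "a (Suc m) \<le> (1 - t) * a m + t * s m"
        using u_in_Suc(2)[OF u_in_add[OF k], of m] by (simp add: a_def s_def t_def algebra_simps)
      then have "(a (Suc m))\<^sup>2 \<le> ((1 - t) * a m + t * s m)\<^sup>2" using a by (intro power_mono)
      also have "\<dots> \<le> (1 - t) * (a m)\<^sup>2 + t * (s m)\<^sup>2"
        using convex_onD[OF convex_power2, of t "a m" "s m"] t by simp
      also have "\<dots> \<le> (1 - \<tau>0) * (a m)\<^sup>2 + 1 * (s m)\<^sup>2"
        using t by (intro add_mono mult_right_mono) auto
      finally show ?thesis by (simp add: algebra_simps)
    qed
    show "summable (\<lambda>m. (s m)\<^sup>2)"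
      unfolding s_def using summable_ignore_initial_segment[OF summable_objective_v_square[OF x]] .
  qed (use tau_bounds(1) in auto)
  then have "summable (\<lambda>m. (a m)\<^sup>2)" using tau_bounds(1) by (simp add: summable_cmult_iff)
  then have "a \<longlonglongrightarrow> 0" using tendsto_real_sqrt[OF summable_LIMSEQ_zero] a by force
  then show ?thesis by (simp add: a_def[abs_def])
qed

lemma summable_objective_u:
  assumes x: "minimizer x" and k: "u k \<in> D" and \<tau>: "summable (\<lambda>m. 1 - \<tau> m)"
  shows "summable (\<lambda>m. h (u (m + k)) - h x)"
proof -
  have u: "h x \<le> h (u (m + k))" for m using x u_in_add[OF k] by (simp add: minimizer_def)
  have "summable (\<lambda>m. \<tau>0 * (h (u (m + k)) - h x))"
  proof (rule summable_of_telescoping_bound)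
    show "(h (u (Suc m + k)) - h x) + \<tau>0 * (h (u (m + k)) - h x)
        \<le> (h (u (m + k)) - h x) + (h (v (m + k)) - h x)" for m
    proof -
      have "\<tau>0 * (h (u (m + k)) - h x) \<le> \<tau> (m + k) * (h (u (m + k)) - h x)"
        using tau_bounds(2) u[of m] by (intro mult_right_mono) auto
      moreover have "\<tau> (m + k) * (h (v (m + k)) - h x) \<le> h (v (m + k)) - h x"
        using tau_pos[of "m + k"] tau_bounds(3)[of "m + k"] objective_v_nonneg[OF x]
        by (intro mult_left_le_one_le) auto
      ultimately show ?thesis
        using u_in_Suc(2)[OF u_in_add[OF k], of m] by (simp add: algebra_simps)
    qed
    show "summable (\<lambda>m. h (v (m + k)) - h x)"
      using summable_ignore_initial_segment[OF summable_objective_v[OF x \<tau>]] .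
  qed (use u tau_bounds(1) objective_v_nonneg[OF x] in auto)
  then show ?thesis using tau_bounds(1) by (simp add: summable_cmult_iff)
qed

text \<open>With \<open>z = u m\<close> in \<open>v_step\<close> the gradient terms cancel, and
  \<open>(norm (v m - u m))\<^sup>2\<close> keeps the coefficient
  \<open>\<gamma> m * \<beta> / 2 - 1\<close>, which is not positive. Only the error survives;
  \<open>3 * M\<close> bounds \<open>norm (u m - v m) + e m\<close>.\<close>

lemma objective_quasi_decreasing:
  assumes x: "minimizer x"
  obtains C where "0 \<le> C" "\<And>m. u m \<in> D \<Longrightarrow> h (u (Suc m)) \<le> h (u m) + C * e m"
proof -
  obtain M where M: "0 \<le> M" "\<And>m. norm (u m - x) \<le> M" "\<And>m. norm (v m - x) \<le> M" "\<And>m. e m \<le> M"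
    using iterates_bounded[OF x] by blast
  define C where "C = 3 * M / \<gamma>0"
  have C: "0 \<le> C" using M(1) gamma_bounds(1) by (simp add: C_def)
  show thesis
  proof (rule that[OF C])
    fix m
    assume um: "u m \<in> D"
    have d: "norm (u m - v m) \<le> 2 * M"
      using norm_triangle_ineq4[of "u m - x" "v m - x"] M(2,3)[of m] by simp
    have "F (v m) - F (u m) \<le> gradF (u m) \<bullet> (v m - u m) + \<beta> / 2 * (norm (v m - u m))\<^sup>2"
      using descent[of "v m" "u m"] by simp
    then have "\<gamma> m * (F (v m) - F (u m))
        \<le> \<gamma> m * (gradF (u m) \<bullet> (v m - u m) + \<beta> / 2 * (norm (v m - u m))\<^sup>2)"
      using gamma_pos[of m] by (intro mult_left_mono) auto
    moreover note v_step[OF um, of m]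
    moreover have "(u m - v m) \<bullet> (v m - u m) = - (norm (v m - u m))\<^sup>2"
      by (simp add: power2_norm_eq_inner algebra_simps inner_commute)
    moreover have "\<gamma> m * \<beta> * (norm (v m - u m))\<^sup>2 \<le> 2 * (norm (v m - u m))\<^sup>2"
      by (intro mult_right_mono gamma_beta_le) auto
    moreover have "e m * norm (u m - v m) + (e m)\<^sup>2 \<le> 3 * M * e m"
    proof -
      have "e m * (norm (u m - v m) + e m) \<le> e m * (2 * M + M)"
        using d M(4) e_nonneg by (intro mult_left_mono add_mono) auto
      then show ?thesis by (simp add: power2_eq_square algebra_simps)
    qed
    ultimately have "\<gamma> m * (h (v m) - h (u m)) \<le> 3 * M * e m"
      unfolding h_def by (simp add: algebra_simps inner_commute)
    then have "h (v m) - h (u m) \<le> 3 * M * e m / \<gamma> m"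
      using gamma_pos[of m] by (simp add: field_simps)
    also have "\<dots> \<le> 3 * M * e m / \<gamma>0"
      using gamma_bounds(1) gamma_bounds(2)[of m] gamma_pos[of m] M(1) e_nonneg[of m]
      by (intro divide_left_mono) auto
    finally have "\<tau> m * (h (v m) - h (u m)) \<le> \<tau> m * (C * e m)"
      using tau_pos[of m] by (intro mult_left_mono) (auto simp: C_def)
    also have "\<dots> \<le> C * e m"
      using tau_pos[of m] tau_bounds(3)[of m] C e_nonneg[of m] by (intro mult_left_le_one_le) auto
    finally show "h (u (Suc m)) \<le> h (u m) + C * e m"
      using u_in_Suc(2)[OF um] by (simp add: algebra_simps)
  qed
qed

lemma objective_rate:
  assumes x: "minimizer x" and k: "u k \<in> D" and \<tau>: "summable (\<lambda>m. 1 - \<tau> m)"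
    and e: "summable (\<lambda>m. real m * e m)"
  shows "(\<lambda>m. real (m + k) * (h (u (m + k)) - h x)) \<longlonglongrightarrow> 0"
proof -
  obtain C where C: "0 \<le> C" "\<And>m. u m \<in> D \<Longrightarrow> h (u (Suc m)) \<le> h (u m) + C * e m"
    using objective_quasi_decreasing[OF x] by blast
  have "(\<lambda>m. real m * (h (u (m + k)) - h x)) \<longlonglongrightarrow> 0"
  proof (rule quasi_decreasing_summable_rate)
    show "summable (\<lambda>m. real m * (C * e (m + k)))"
    proof (rule summable_comparison_test')
      show "summable (\<lambda>m. C * (real (m + k) * e (m + k)))"
        using summable_ignore_initial_segment[OF e, of k] by (rule summable_mult)
      show "norm (real m * (C * e (m + k))) \<le> C * (real (m + k) * e (m + k))" for m
        using C(1) e_nonneg[of "m + k"] by (simp add: algebra_simps)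
    qed
    show "h (u (Suc m + k)) - h x \<le> h (u (m + k)) - h x + C * e (m + k)" for m
      using C(2)[OF u_in_add[OF k]] by simp
    show "0 \<le> h (u (m + k)) - h x" for m
      using x u_in_add[OF k] by (simp add: minimizer_def)
  qed (use C e_nonneg summable_objective_u[OF x k \<tau>] in auto)
  \<comment> \<open>The shift is undone by splitting the factor \<open>m + k\<close>: the part with
    the fixed factor \<open>k\<close> vanishes because the gaps do.\<close>
  from tendsto_add[OF this tendsto_mult_right_zero[OF objective_u_tendsto[OF x k], of "real k"]]
  show ?thesis by (simp add: algebra_simps)
qed

end

section \<open>Extended real-valued convex functions\<close>

lemma proper_ereal_real:
  assumes "proper G" "G z < \<infinity>"
  shows "ereal (real_of_ereal (G z)) = G z"
proof -
  have "G z \<noteq> - \<infinity>" using assms(1) by (simp add: proper_def)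
  then show ?thesis using assms(2) by (cases "G z") auto
qed

lemma econvex_convex_on:
  assumes G: "proper G" "econvex G"
  shows "convex_on {z. G z < \<infinity>} (\<lambda>z. real_of_ereal (G z))"
proof -
  have *: "G ((1 - t) *\<^sub>R x + t *\<^sub>R y)
      \<le> ereal ((1 - t) * real_of_ereal (G x) + t * real_of_ereal (G y))"
    if x: "G x < \<infinity>" and y: "G y < \<infinity>" and t: "0 < t" "t < 1" for x y t
  proof -
    have "G ((1 - t) *\<^sub>R x + (1 - (1 - t)) *\<^sub>R y) \<le> ereal (1 - t) * G x + ereal (1 - (1 - t)) * G y"
      using G(2)[unfolded econvex_def, rule_format, of "1 - t" x y] t by simp
    also have "\<dots> = ereal (1 - t) * ereal (real_of_ereal (G x)) + ereal t * ereal (real_of_ereal (G y))"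
      by (simp only: proper_ereal_real[OF G(1)] x y diff_diff_eq2 add_diff_cancel_left')
    finally show ?thesis by simp
  qed
  show ?thesis
  proof (rule convex_onI)
    show "convex {z. G z < \<infinity>}"
      unfolding convex_alt
    proof (intro ballI allI impI)
      fix x y :: 'a and t :: real
      assume xy: "x \<in> {z. G z < \<infinity>}" "y \<in> {z. G z < \<infinity>}" and t: "0 \<le> t \<and> t \<le> 1"
      show "(1 - t) *\<^sub>R x + t *\<^sub>R y \<in> {z. G z < \<infinity>}"
      proof (cases "t = 0 \<or> t = 1")
        case True
        then show ?thesis using xy by auto
      next
        case False
        then have "G ((1 - t) *\<^sub>R x + t *\<^sub>R y)
            \<le> ereal ((1 - t) * real_of_ereal (G x) + t * real_of_ereal (G y))"
          using xy t by (intro *) auto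
        also have "\<dots> < \<infinity>" by simp
        finally show ?thesis by simp
      qed
    qed
    show "real_of_ereal (G ((1 - t) *\<^sub>R x + t *\<^sub>R y))
        \<le> (1 - t) * real_of_ereal (G x) + t * real_of_ereal (G y)"
      if t: "0 < t" "t < 1" and xy: "x \<in> {z. G z < \<infinity>}" "y \<in> {z. G z < \<infinity>}" for t x y
    proof -
      have le: "G ((1 - t) *\<^sub>R x + t *\<^sub>R y)
          \<le> ereal ((1 - t) * real_of_ereal (G x) + t * real_of_ereal (G y))"
        using t xy by (intro *) auto
      also have "\<dots> < \<infinity>" by simp
      finally have "ereal (real_of_ereal (G ((1 - t) *\<^sub>R x + t *\<^sub>R y))) = G ((1 - t) *\<^sub>R x + t *\<^sub>R y)"
        by (rule proper_ereal_real[OF G(1)])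
      with le show ?thesis by (metis ereal_less_eq(3))
    qed
  qed
qed

text \<open>A limit of such points might leave the domain of \<open>G\<close>, and
  \<open>real_of_ereal\<close> would hide this by returning 0. Lower semicontinuity therefore bounds
  \<open>G l\<close> in the extended reals before any conversion.\<close>

lemma closed_sublevel_sum:
  fixes F :: "'a::real_normed_vector \<Rightarrow> real"
  assumes G: "proper G" "lower_semicontinuous G" and F: "continuous_on UNIV F"
  shows "closed {z \<in> {z. G z < \<infinity>}. F z + real_of_ereal (G z) \<le> c}"
  unfolding closed_sequential_limits
proof (intro allI impI, elim conjE)
  fix x l
  assume x: "\<forall>n. x n \<in> {z \<in> {z. G z < \<infinity>}. F z + real_of_ereal (G z) \<le> c}" and l: "x \<longlonglongrightarrow> l"
  have le: "G (x n) \<le> ereal (c - F (x n))" for n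
  proof -
    have "ereal (real_of_ereal (G (x n))) \<le> ereal (c - F (x n))" using x[rule_format, of n] by simp
    moreover have "G (x n) < \<infinity>" using x by blast
    ultimately show ?thesis by (simp only: proper_ereal_real[OF G(1)])
  qed
  have "isCont F l" using F by (simp add: continuous_on_eq_continuous_at)
  then have lim: "(\<lambda>n. ereal (c - F (x n))) \<longlonglongrightarrow> ereal (c - F l)"
    using isCont_tendsto_compose[OF _ l] by (intro tendsto_intros) auto
  have "G l \<le> ereal (c - F l)"
  proof (rule ccontr)
    assume "\<not> ?thesis"
    then obtain y where y: "ereal (c - F l) < y" "y < G l" using dense by (auto simp: not_le)
    then have "y < Liminf (nhds l) G"
      using G(2) unfolding lower_semicontinuous_def by (blast intro: less_le_trans)
    then have "\<forall>\<^sub>F z in nhds l. y < G z" by (rule less_LiminfD)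
    then have "\<forall>\<^sub>F n in sequentially. y < G (x n)"
      using l by (rule eventually_compose_filterlim)
    moreover have "\<forall>\<^sub>F n in sequentially. ereal (c - F (x n)) < y"
      by (rule order_tendstoD(2)[OF lim y(1)])
    ultimately have "\<forall>\<^sub>F n in sequentially. False"
      by eventually_elim (use le in \<open>meson less_asym less_le_trans\<close>)
    then show False by simp
  qed
  moreover have "ereal (c - F l) < \<infinity>" by simp
  ultimately have Gl: "G l < \<infinity>" by (rule le_less_trans)
  with \<open>G l \<le> ereal (c - F l)\<close> have "ereal (real_of_ereal (G l)) \<le> ereal (c - F l)"
    by (simp only: proper_ereal_real[OF G(1)])
  then show "l \<in> {z \<in> {z. G z < \<infinity>}. F z + real_of_ereal (G z) \<le> c}"
    using Gl by simp
qed

text \<open>The infimum enters only through its upper bounds at points of the domain; one such point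
  already forces \<open>G v\<close> to be finite.\<close>

lemma approx_prox_inequality:
  fixes G :: "'a::real_inner \<Rightarrow> ereal"
  assumes G: "proper G" "econvex G" and \<gamma>: "0 < \<gamma>" and \<delta>: "0 \<le> \<delta>"
    and prox: "approx_prox \<delta> (\<lambda>x. ereal \<gamma> * G x) w v"
  shows "G v < \<infinity>"
    and "G z < \<infinity> \<Longrightarrow> \<gamma> * (real_of_ereal (G v) - real_of_ereal (G z))
      \<le> (z - v) \<bullet> (v - w) + \<delta> * norm (z - v) + \<delta>\<^sup>2"
proof -
  define D where "D = {z. G z < \<infinity>}"
  define g where "g z = real_of_ereal (G z)" for z
  have fin: "G z = ereal (g z)" if "z \<in> D" for z
    using proper_ereal_real[OF G(1)] that by (simp add: D_def g_def)
  have le: "ereal \<gamma> * G v + ereal (1/2 * (norm (v - w))\<^sup>2)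
      \<le> ereal (\<gamma> * g z + 1/2 * (norm (z - w))\<^sup>2 + \<delta>\<^sup>2 / 2)" if "z \<in> D" for z
  proof -
    have "(INF v. ereal \<gamma> * G v + ereal (1/2 * (norm (v - w))\<^sup>2))
        \<le> ereal \<gamma> * G z + ereal (1/2 * (norm (z - w))\<^sup>2)" by (rule INF_lower) simp
    also have "\<dots> = ereal (\<gamma> * g z + 1/2 * (norm (z - w))\<^sup>2)" by (simp add: fin[OF that])
    finally have "(INF v. ereal \<gamma> * G v + ereal (1/2 * (norm (v - w))\<^sup>2)) + ereal (\<delta>\<^sup>2 / 2)
        \<le> ereal (\<gamma> * g z + 1/2 * (norm (z - w))\<^sup>2) + ereal (\<delta>\<^sup>2 / 2)"
      by (rule add_right_mono)
    with prox show ?thesis unfolding approx_prox_def by (auto intro: order_trans)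
  qed
  obtain z0 where "z0 \<in> D" using G(1) unfolding proper_def D_def by (auto simp: less_top[symmetric])
  from le[OF this] show v: "G v < \<infinity>" using \<gamma> by (cases "G v") auto
  then have vD: "v \<in> D" by (simp add: D_def)
  have conv: "convex_on D (\<lambda>z. \<gamma> * g z)"
    unfolding D_def g_def using econvex_convex_on[OF G] \<gamma> by (intro convex_on_cmul) auto
  assume "G z < \<infinity>"
  then have "z \<in> D" by (simp add: D_def)
  moreover have "\<gamma> * g v + 1/2 * (norm (v - w))\<^sup>2 \<le> \<gamma> * g y + 1/2 * (norm (y - w))\<^sup>2 + \<delta>\<^sup>2 / 2"
    if "y \<in> D" for y
    using le[OF that] by (simp add: fin[OF vD])
  ultimately have "\<gamma> * g v - \<gamma> * g z \<le> (z - v) \<bullet> (v - w) + \<delta> * norm (z - v) + \<delta>\<^sup>2"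
    by (intro approx_minimizer_inequality[OF conv vD _ \<delta>])
  then show "\<gamma> * (real_of_ereal (G v) - real_of_ereal (G z))
      \<le> (z - v) \<bullet> (v - w) + \<delta> * norm (z - v) + \<delta>\<^sup>2"
    by (simp add: g_def right_diff_distrib)
qed

lemma suminf_ereal_less_infinity:
  assumes "summable f"
  shows "(\<Sum>n. ereal (f n)) < \<infinity>"
proof -
  have "(\<lambda>n. ereal (f n)) sums ereal (suminf f)"
    using summable_sums[OF assms] by (simp add: sums_ereal)
  then have "(\<Sum>n. ereal (f n)) = ereal (suminf f)" by (rule sums_unique[symmetric])
  then show ?thesis by simp
qed

section \<open>From finite values on \<open>D\<close> back to the extended objective
  \<open>J\<close>\<close>

theorem theorem2p7:
  fixes F :: "'a::{real_inner, complete_space} \<Rightarrow> real"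
    and gradF :: "'a \<Rightarrow> 'a"
    and G J :: "'a \<Rightarrow> ereal"
    and \<beta> :: real
    and \<gamma> \<tau> \<delta> :: "nat \<Rightarrow> real"
    and b u v :: "nat \<Rightarrow> 'a"
  assumes F_convex: "convex_on UNIV F"
    and F_grad: "\<And>x. GDERIV F x :> gradF x"
    and beta_pos: "0 < \<beta>"
    and grad_lipschitz: "\<beta>-lipschitz_on UNIV gradF"
    and G: "G \<in> Gamma0"
    and J: "J = (\<lambda>x. ereal (F x) + G x)"
    and argmin_nonempty: "Argmin J \<noteq> {}"
    and gamma_pos: "\<And>m. 0 < \<gamma> m"
    and gamma_inf: "0 < (INF m. \<gamma> m)"
    and gamma_bdd: "bdd_above (range \<gamma>)"
    and gamma_sup: "(SUP m. \<gamma> m) < 2 / \<beta>"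
    and tau_range: "\<And>m. 0 < \<tau> m \<and> \<tau> m \<le> 1"
    and tau_inf: "0 < (INF m. \<tau> m)"
    and delta_nonneg: "\<And>m. 0 \<le> \<delta> m"
    and delta_summable: "summable \<delta>"
    and b_summable: "summable (\<lambda>m. norm (b m))"
    and v_step: "\<And>m. approx_prox (\<delta> m) (\<lambda>x. ereal (\<gamma> m) * G x)
                        (u m - \<gamma> m *\<^sub>R (gradF (u m) + b m)) (v m)"
    and u_step: "\<And>m. u (Suc m) = u m + \<tau> m *\<^sub>R (v m - u m)"
  shows "(\<exists>x \<in> Argmin J. weakly_converges u x)
    \<and> (\<forall>x \<in> Argmin J. summable (\<lambda>m. (norm (gradF (u m) - gradF x))\<^sup>2))
    \<and> summable (\<lambda>m. (norm (v m - u m))\<^sup>2)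
    \<and> (((\<exists>k. G (u k) < \<infinity>) \<longrightarrow> (\<lambda>m. J (u m)) \<longlonglongrightarrow> (INF x. J x))
        \<and> (\<Sum>m. \<bar>J (v m) - (INF x. J x)\<bar>\<^sup>2) < \<infinity>)
    \<and> (summable (\<lambda>m. 1 - \<tau> m) \<longrightarrow>
          (\<Sum>m. J (v m) - (INF x. J x)) < \<infinity>
        \<and> (G (u 0) < \<infinity> \<longrightarrow> (\<Sum>m. J (u m) - (INF x. J x)) < \<infinity>))
    \<and> (summable (\<lambda>m. 1 - \<tau> m) \<and> summable (\<lambda>m. real m * \<delta> m)
          \<and> summable (\<lambda>m. real m * norm (b m))
          \<and> (\<exists>k. G (u k) < \<infinity>) \<longrightarrow>
          (\<forall>\<^sub>F m in sequentially. J (u m) < \<infinity>)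
        \<and> (\<lambda>m. real_of_ereal (J (u m) - (INF x. J x))) \<in> o(\<lambda>m. 1 / real m))"
proof -
  have G_props: "proper G" "lower_semicontinuous G" "econvex G" using G by (auto simp: Gamma0_def)
  define D where "D = {z. G z < \<infinity>}"
  define g where "g z = real_of_ereal (G z)" for z
  \<comment> \<open>By Cauchy-Schwarz the gradient error adds at most
    \<open>\<gamma> m * norm (b m) * norm (z - v m)\<close> to the proximal inequality, so it can be
    counted with \<open>\<delta> m\<close>.\<close>
  define e where "e m = \<delta> m + \<gamma> m * norm (b m)" for m
  define \<gamma>1 where "\<gamma>1 = (SUP m. \<gamma> m)"
  have \<gamma>1: "\<gamma> m \<le> \<gamma>1" for m unfolding \<gamma>1_def by (rule cSUP_upper[OF _ gamma_bdd]) simp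
  have e0: "0 \<le> e m" for m using delta_nonneg gamma_pos[of m] by (simp add: e_def)
  \<comment> \<open>Needed for the weights \<open>c m = 1\<close> and
    \<open>c m = m\<close>.\<close>
  have weighted: "summable (\<lambda>m. c m * e m)"
    if c: "\<And>m. 0 \<le> c m" "summable (\<lambda>m. c m * \<delta> m)" "summable (\<lambda>m. c m * norm (b m))" for c
  proof (rule summable_comparison_test')
    show "summable (\<lambda>m. c m * \<delta> m + \<gamma>1 * (c m * norm (b m)))"
      using c by (intro summable_add summable_mult)
    show "norm (c m * e m) \<le> c m * \<delta> m + \<gamma>1 * (c m * norm (b m))" for m
    proof -
      have "\<gamma> m * (c m * norm (b m)) \<le> \<gamma>1 * (c m * norm (b m))"
        using \<gamma>1 c(1) by (intro mult_right_mono) auto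
      moreover have "norm (c m * e m) = c m * \<delta> m + \<gamma> m * (c m * norm (b m))"
        using c(1)[of m] e0[of m] by (simp add: abs_mult) (simp add: e_def algebra_simps)
      ultimately show ?thesis by simp
    qed
  qed
  interpret fb: forward_backward F g gradF D \<beta> "INF m. \<gamma> m" \<gamma>1 "INF m. \<tau> m" \<gamma> \<tau> e u v
  proof
    show "convex_on D g"
      unfolding D_def g_def by (rule econvex_convex_on) (rule G_props)+
    have "isCont F z" for z
      using F_grad[of z] unfolding gderiv_def by (rule has_derivative_continuous)
    then have "continuous_on UNIV F" by (simp add: continuous_on_eq_continuous_at)
    then show "closed {z \<in> D. F z + g z \<le> c}" for c
      unfolding D_def g_def using G_props by (intro closed_sublevel_sum)
    have "bdd_below (range \<gamma>)" "bdd_below (range \<tau>)"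
      using gamma_pos tau_range by (meson bdd_belowI2 less_imp_le)+
    then show "(INF m. \<gamma> m) \<le> \<gamma> m" "(INF m. \<tau> m) \<le> \<tau> m" for m
      by (auto intro: cINF_lower)
    show "summable e" using weighted[of "\<lambda>_. 1"] delta_summable b_summable by simp
    note prox = approx_prox_inequality[OF G_props(1,3) gamma_pos delta_nonneg v_step]
    show "v m \<in> D" for m using prox(1) by (simp add: D_def)
    show "\<gamma> m * (g (v m) - g z) \<le> (z - v m) \<bullet> (v m - u m) + \<gamma> m * ((z - v m) \<bullet> gradF (u m))
        + e m * norm (z - v m) + (e m)\<^sup>2" if "z \<in> D" for m z
    proof -
      have "\<gamma> m * ((z - v m) \<bullet> b m) \<le> \<gamma> m * (norm (z - v m) * norm (b m))"
        using gamma_pos[of m] norm_cauchy_schwarz by (intro mult_left_mono) auto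
      moreover have "(\<delta> m)\<^sup>2 \<le> (e m)\<^sup>2"
        using delta_nonneg gamma_pos[of m] by (intro power_mono) (auto simp: e_def)
      moreover have "(z - v m) \<bullet> (v m - (u m - \<gamma> m *\<^sub>R (gradF (u m) + b m)))
          = (z - v m) \<bullet> (v m - u m) + \<gamma> m * ((z - v m) \<bullet> gradF (u m)) + \<gamma> m * ((z - v m) \<bullet> b m)"
        by (simp add: inner_diff_right inner_add_right algebra_simps)
      moreover have "e m * norm (z - v m)
          = \<delta> m * norm (z - v m) + \<gamma> m * (norm (z - v m) * norm (b m))"
        by (simp add: e_def algebra_simps)
      ultimately show ?thesis using prox(2)[of z m] that unfolding D_def g_def mem_Collect_eq by linarith
    qed
    show "\<gamma>1 < 2 / \<beta>" unfolding \<gamma>1_def by (rule gamma_sup)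
    show "\<tau> m \<le> 1" for m using tau_range by blast
    show "convex_on UNIV F" by (rule F_convex)
    show "\<And>x. GDERIV F x :> gradF x" by (rule F_grad)
    show "0 < \<beta>" by (rule beta_pos)
    show "\<beta>-lipschitz_on UNIV gradF" by (rule grad_lipschitz)
    show "0 < (INF m. \<gamma> m)" "0 < (INF m. \<tau> m)" by (rule gamma_inf tau_inf)+
    show "\<gamma> m \<le> \<gamma>1" "0 \<le> e m" "u (Suc m) = u m + \<tau> m *\<^sub>R (v m - u m)" for m
      by (rule \<gamma>1 e0 u_step)+
  qed
  have J_in: "J z = ereal (fb.h z)" if "z \<in> D" for z
    using G_props(1) that unfolding proper_def D_def g_def fb.h_def J
    by (cases "G z") auto
  have J_notin: "J z = \<infinity>" if "z \<notin> D" for z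
    using that by (auto simp: J D_def)
  have min_iff: "fb.minimizer x \<longleftrightarrow> x \<in> Argmin J" for x
  proof
    assume x: "fb.minimizer x"
    have "\<not> J y < J x" for y
      using x by (cases "y \<in> D") (auto simp: fb.minimizer_def J_in J_notin not_less)
    then show "x \<in> Argmin J" by (simp add: Argmin_def is_arg_min_def)
  next
    assume "x \<in> Argmin J"
    then have le: "J x \<le> J y" for y by (auto simp: Argmin_def is_arg_min_def not_less)
    have xD: "x \<in> D" using le[of "v 0"] J_in[OF fb.v_in, of 0] J_notin[of x] by (cases "x \<in> D") auto
    have "fb.h x \<le> fb.h z" if "z \<in> D" for z
      using le[of z] by (simp add: J_in xD that)
    then show "fb.minimizer x"
      unfolding fb.minimizer_def using xD by blast
  qed
  obtain x where "x \<in> Argmin J" using argmin_nonempty by blast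
  then have x: "fb.minimizer x" by (simp add: min_iff)
  have inf_J: "(INF z. J z) = ereal (fb.h x)"
  proof (rule antisym)
    show "(INF z. J z) \<le> ereal (fb.h x)"
      using x J_in[of x] by (intro INF_lower2[of x]) (auto simp: fb.minimizer_def)
    show "ereal (fb.h x) \<le> (INF z. J z)"
    proof (rule INF_greatest)
      fix z
      show "ereal (fb.h x) \<le> J z"
        using x by (cases "z \<in> D") (auto simp: fb.minimizer_def J_in J_notin)
    qed
  qed
  have J_v: "J (v m) - (INF z. J z) = ereal (fb.h (v m) - fb.h x)" for m
    by (simp add: inf_J J_in fb.v_in)
  have J_u: "J (u (m + k)) = ereal (fb.h (u (m + k)))" if "G (u k) < \<infinity>" for m k
    using that by (intro J_in fb.u_in_add) (simp add: D_def)
  have objective_lim: "(\<lambda>m. J (u m)) \<longlonglongrightarrow> (INF x. J x)" if k: "G (u k) < \<infinity>" for k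
  proof (rule LIMSEQ_offset[of _ k])
    have "(\<lambda>m. fb.h (u (m + k))) \<longlonglongrightarrow> fb.h x"
      using fb.objective_u_tendsto[OF x, of k] k by (simp add: D_def LIM_zero_iff)
    then show "(\<lambda>m. J (u (m + k))) \<longlonglongrightarrow> (INF x. J x)" by (simp add: J_u[OF k] inf_J)
  qed
  have squares: "(\<Sum>m. \<bar>J (v m) - (INF x. J x)\<bar>\<^sup>2) < \<infinity>"
    using suminf_ereal_less_infinity[OF fb.summable_objective_v_square[OF x]] by (simp add: J_v)
  have sums: "(\<Sum>m. J (v m) - (INF x. J x)) < \<infinity>"
    "G (u 0) < \<infinity> \<longrightarrow> (\<Sum>m. J (u m) - (INF x. J x)) < \<infinity>"
    if \<tau>: "summable (\<lambda>m. 1 - \<tau> m)"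
  proof -
    show "(\<Sum>m. J (v m) - (INF x. J x)) < \<infinity>"
      using suminf_ereal_less_infinity[OF fb.summable_objective_v[OF x \<tau>]] by (simp add: J_v)
    \<comment> \<open>The series includes the term of index 0, so the shift has to be 0
      here.\<close>
    show "G (u 0) < \<infinity> \<longrightarrow> (\<Sum>m. J (u m) - (INF x. J x)) < \<infinity>"
      using suminf_ereal_less_infinity[OF fb.summable_objective_u[OF x _ \<tau>, of 0]] J_u[of 0]
      by (simp add: D_def inf_J)
  qed
  \<comment> \<open>Eventual finiteness is claimed along with the rate, since
    \<open>real_of_ereal\<close> sends infinite gaps to 0 and the little-o bound alone would not
    exclude them.\<close>
  have rate: "(\<forall>\<^sub>F m in sequentially. J (u m) < \<infinity>)
      \<and> (\<lambda>m. real_of_ereal (J (u m) - (INF x. J x))) \<in> o(\<lambda>m. 1 / real m)"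
    if \<tau>: "summable (\<lambda>m. 1 - \<tau> m)" and m: "summable (\<lambda>m. real m * \<delta> m)"
      "summable (\<lambda>m. real m * norm (b m))" and k: "G (u k) < \<infinity>" for k
  proof
    have "J (u m) < \<infinity>" if "k \<le> m" for m
      using J_u[OF k, of "m - k"] that by simp
    then show "\<forall>\<^sub>F m in sequentially. J (u m) < \<infinity>" unfolding eventually_sequentially by blast
    show "(\<lambda>m. real_of_ereal (J (u m) - (INF x. J x))) \<in> o(\<lambda>m. 1 / real m)"
    proof (rule smalloI_tendsto)
      show "(\<lambda>m. real_of_ereal (J (u m) - (INF x. J x)) / (1 / real m)) \<longlonglongrightarrow> 0"
      proof (rule LIMSEQ_offset[of _ k])
        have "summable (\<lambda>m. real m * e m)" using m by (intro weighted) auto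
        from fb.objective_rate[OF x _ \<tau> this, of k] k
        show "(\<lambda>m. real_of_ereal (J (u (m + k)) - (INF x. J x)) / (1 / real (m + k))) \<longlonglongrightarrow> 0"
          by (simp add: D_def J_u[OF k] inf_J mult.commute del: of_nat_add)
      qed
      show "\<forall>\<^sub>F m in sequentially. 1 / real m \<noteq> 0"
        using eventually_gt_at_top[of 0] by eventually_elim simp
    qed
  qed
  show ?thesis
  proof (intro conjI)
    show "\<exists>x\<in>Argmin J. weakly_converges u x"
      using fb.weak_convergence[OF x] by (auto simp: min_iff)
    show "\<forall>x\<in>Argmin J. summable (\<lambda>m. (norm (gradF (u m) - gradF x))\<^sup>2)"
      using fb.summable_residuals(2) by (simp add: min_iff)
    show "summable (\<lambda>m. (norm (v m - u m))\<^sup>2)" by (rule fb.summable_residuals(1)[OF x])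
    show "(\<exists>k. G (u k) < \<infinity>) \<longrightarrow> (\<lambda>m. J (u m)) \<longlonglongrightarrow> (INF x. J x)"
      by (intro impI) (elim exE, rule objective_lim)
    show "(\<Sum>m. \<bar>J (v m) - (INF x. J x)\<bar>\<^sup>2) < \<infinity>" by (rule squares)
    show "summable (\<lambda>m. 1 - \<tau> m) \<longrightarrow> (\<Sum>m. J (v m) - (INF x. J x)) < \<infinity>
        \<and> (G (u 0) < \<infinity> \<longrightarrow> (\<Sum>m. J (u m) - (INF x. J x)) < \<infinity>)"
      by (intro impI conjI sums(1) sums(2)[rule_format])
    show "summable (\<lambda>m. 1 - \<tau> m) \<and> summable (\<lambda>m. real m * \<delta> m)
        \<and> summable (\<lambda>m. real m * norm (b m)) \<and> (\<exists>k. G (u k) < \<infinity>) \<longrightarrow>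
        (\<forall>\<^sub>F m in sequentially. J (u m) < \<infinity>)
      \<and> (\<lambda>m. real_of_ereal (J (u m) - (INF x. J x))) \<in> o(\<lambda>m. 1 / real m)"
      by (rule impI, elim conjE exE, rule rate)
  qed
qed

end
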